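(* Let $0<\alpha<n$, $0\leq\lambda<n$, $1<p<(n-\lambda)/\alpha$ and $\frac1q=\frac1p-\frac{\alpha}{n-\lambda}$. Let $T^\alpha$ be any of the operators $I^\alpha$, $M^\alpha$, $H^\alpha$, $\mathcal{H}^\alpha$. Then $T^\alpha$ is bounded from $V_\infty L^{p,\lambda}(\mathbb{R}^n)$ into $V_\infty L^{q,\lambda}(\mathbb{R}^n)$; that is, $T^\alpha f\in V_\infty L^{q,\lambda}(\mathbb{R}^n)$ for every $f\in V_\infty L^{p,\lambda}(\mathbb{R}^n)$, and $\|T^\alpha f\|_{q,\lambda}\leq C\|f\|_{p,\lambda}$ with $C$ independent of $f$.
   Context: For $1\le p<\infty$, $0\le\lambda\le n$, $x\in\mathbb{R}^n$, $r>0$, let $B(x,r)$ be the open ball and $\mathfrak{M}_{p,\lambda}(f;x,r):=\frac{1}{r^\lambda}\int_{B(x,r)}|f(y)|^p\,dy$. The Morrey space $L^{p,\lambda}(\mathbb{R}^n)$ consists of all locally $p$-integrable $f$ on $\mathbb{R}^n$ with $\|f\|_{p,\lambda}:=\sup_{x\in\mathbb{R}^n,\,r>0}\mathfrak{M}_{p,\lambda}(f;x,r)^{1/p}<\infty$. The subspace $V_\infty L^{p,\lambda}(\mathbb{R}^n)$ consists of all $f\in L^{p,\lambda}(\mathbb{R}^n)$ with $\lim_{r\to\infty}\sup_{x\in\mathbb{R}^n}\mathfrak{M}_{p,\lambda}(f;x,r)=0$. Operators, for $0<\alpha<n$: - Riesz potential $I^\alpha f(x):=\int_{\mathbb{R}^n}\frac{f(y)}{|x-y|^{n-\alpha}}\,dy$;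 - fractional maximal operator $M^\alpha f(x):=\sup_{t>0}\frac{1}{|B(x,t)|^{1-\alpha/n}}\int_{B(x,t)}|f(y)|\,dy$; - Hardy type operators $H^\alpha f(x):=|x|^{\alpha-n}\int_{|y|<|x|}f(y)\,dy$ and $\mathcal{H}^\alpha f(x):=|x|^\alpha\int_{|y|>|x|}\frac{f(y)}{|y|^n}\,dy$. *)

theory Defs
  imports "HOL-Analysis.Analysis"
begin

text \<open>
  The ambient space is \<open>real ^ 'n\<close>, of dimension \<open>n = CARD('n)\<close>. Measurability and integrals
  refer to Lebesgue measure. The parameters \<open>l\<close> and \<open>a\<close> are the Morrey exponent lambda and the
  order alpha of the operators.
\<close>

definition locally_p_integrable :: "real \<Rightarrow> (real ^ 'n \<Rightarrow> 'a::euclidean_space) \<Rightarrow> bool" where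
  "locally_p_integrable p f \<longleftrightarrow>
     f \<in> borel_measurable lebesgue \<and>
     (\<forall>K. compact K \<longrightarrow> set_integrable lebesgue K (\<lambda>y. norm (f y) powr p))"

definition morrey_modular ::
    "real \<Rightarrow> real \<Rightarrow> (real ^ 'n \<Rightarrow> 'a::euclidean_space) \<Rightarrow> real ^ 'n \<Rightarrow> real \<Rightarrow> real" where
  "morrey_modular p l f x r =
     1 / (r powr l) * (LINT y:ball x r|lebesgue. norm (f y) powr p)"

text \<open>
  The suprema below are suprema of reals. They are the intended ones on the Morrey space, whose
  definition demands boundedness of the family in question (for fixed \<open>r\<close> this also bounds
  the family over \<open>x\<close> used for the vanishing subspace).
\<close>

definition morrey_space :: "real \<Rightarrow> real \<Rightarrow> (real ^ 'n \<Rightarrow> 'a::euclidean_space) set" where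
  "morrey_space p l =
     {f. locally_p_integrable p f \<and>
         bdd_above ((\<lambda>(x, r). morrey_modular p l f x r powr (1 / p)) ` (UNIV \<times> {0<..}))}"

definition morrey_norm :: "real \<Rightarrow> real \<Rightarrow> (real ^ 'n \<Rightarrow> 'a::euclidean_space) \<Rightarrow> real" where
  "morrey_norm p l f =
     (SUP (x, r) \<in> UNIV \<times> {0<..}. morrey_modular p l f x r powr (1 / p))"

definition vanishing_morrey_space ::
    "real \<Rightarrow> real \<Rightarrow> (real ^ 'n \<Rightarrow> 'a::euclidean_space) set" where
  "vanishing_morrey_space p l =
     {f \<in> morrey_space p l. ((\<lambda>r. SUP x. morrey_modular p l f x r) \<longlongrightarrow> 0) at_top}"

text \<open>
  The values of the operators need only be defined almost everywhere: the integrals may diverge,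
  and the maximal function may be infinite, at individual points. As the library assigns a default
  value in these cases, each operator comes with a predicate telling where its defining expression
  is meaningful. The value of a real power at base \<open>0\<close> is \<open>0\<close> in the library; this only
  concerns the null sets \<open>y = x\<close> and \<open>x = 0\<close>.
\<close>

definition riesz_defined ::
    "real \<Rightarrow> (real ^ 'n \<Rightarrow> 'a::euclidean_space) \<Rightarrow> real ^ 'n \<Rightarrow> bool" where
  "riesz_defined a f x \<longleftrightarrow>
     integrable lebesgue (\<lambda>y. f y /\<^sub>R (norm (x - y) powr (real CARD('n) - a)))"

definition riesz_potential ::
    "real \<Rightarrow> (real ^ 'n \<Rightarrow> 'a::euclidean_space) \<Rightarrow> real ^ 'n \<Rightarrow> 'a" where
  "riesz_potential a f x =
     (LINT y|lebesgue. f y /\<^sub>R (norm (x - y) powr (real CARD('n) - a)))"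

definition frac_maximal_ext ::
    "real \<Rightarrow> (real ^ 'n \<Rightarrow> 'a::euclidean_space) \<Rightarrow> real ^ 'n \<Rightarrow> ennreal" where
  "frac_maximal_ext a f x =
     (SUP t \<in> {0<..}.
        (\<integral>\<^sup>+ y \<in> ball x t. ennreal (norm (f y)) \<partial>lebesgue) /
        ennreal (measure lebesgue (ball x t) powr (1 - a / real CARD('n))))"

definition frac_maximal_defined ::
    "real \<Rightarrow> (real ^ 'n \<Rightarrow> 'a::euclidean_space) \<Rightarrow> real ^ 'n \<Rightarrow> bool" where
  "frac_maximal_defined a f x \<longleftrightarrow> frac_maximal_ext a f x < \<infinity>"

definition frac_maximal ::
    "real \<Rightarrow> (real ^ 'n \<Rightarrow> 'a::euclidean_space) \<Rightarrow> real ^ 'n \<Rightarrow> real" where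
  "frac_maximal a f x = enn2real (frac_maximal_ext a f x)"

definition hardy_defined ::
    "real \<Rightarrow> (real ^ 'n \<Rightarrow> 'a::euclidean_space) \<Rightarrow> real ^ 'n \<Rightarrow> bool" where
  "hardy_defined a f x \<longleftrightarrow> set_integrable lebesgue {y. norm y < norm x} f"

definition hardy ::
    "real \<Rightarrow> (real ^ 'n \<Rightarrow> 'a::euclidean_space) \<Rightarrow> real ^ 'n \<Rightarrow> 'a" where
  "hardy a f x =
     (norm x powr (a - real CARD('n))) *\<^sub>R (LINT y:{y. norm y < norm x}|lebesgue. f y)"

definition dual_hardy_defined ::
    "real \<Rightarrow> (real ^ 'n \<Rightarrow> 'a::euclidean_space) \<Rightarrow> real ^ 'n \<Rightarrow> bool" where
  "dual_hardy_defined a f x \<longleftrightarrow>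
     set_integrable lebesgue {y. norm y > norm x} (\<lambda>y. f y /\<^sub>R (norm y ^ CARD('n)))"

definition dual_hardy ::
    "real \<Rightarrow> (real ^ 'n \<Rightarrow> 'a::euclidean_space) \<Rightarrow> real ^ 'n \<Rightarrow> 'a" where
  "dual_hardy a f x =
     (norm x powr a) *\<^sub>R
       (LINT y:{y. norm y > norm x}|lebesgue. f y /\<^sub>R (norm y ^ CARD('n)))"

text \<open>
  Boundedness of an operator \<open>T\<close>, whose value \<open>T f x\<close> is meaningful where \<open>D f x\<close> holds,
  between vanishing Morrey spaces.
\<close>

definition bounded_on_vanishing_morrey ::
    "real \<Rightarrow> real \<Rightarrow> real \<Rightarrow>
     ((real ^ 'n \<Rightarrow> 'a::euclidean_space) \<Rightarrow> real ^ 'n \<Rightarrow> bool) \<Rightarrow>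
     ((real ^ 'n \<Rightarrow> 'a) \<Rightarrow> real ^ 'n \<Rightarrow> 'b::euclidean_space) \<Rightarrow> bool" where
  "bounded_on_vanishing_morrey p q l D T \<longleftrightarrow>
     (\<exists>C. \<forall>f \<in> vanishing_morrey_space p l.
        (AE x in lebesgue. D f x) \<and>
        T f \<in> vanishing_morrey_space q l \<and>
        morrey_norm q l (T f) \<le> C * morrey_norm p l f)"

end

theory Submission
  imports Defs
begin

text \<open>
  All four operators are dominated pointwise by a constant times the Riesz potential of \<open>|f|\<close>.
  Hedberg's inequality bounds that potential by \<open>C (M f) powr (p / q) * A powr (1 - p / q)\<close>, where
  \<open>M\<close> is the Hardy-Littlewood maximal operator and \<open>A\<close> the Morrey norm of \<open>f\<close>. Hence its
  \<open>q\<close>-modular is at most \<open>C A powr (q - p)\<close> times the \<open>p\<close>-modular of \<open>M f\<close>, which on balls of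
  radius \<open>r\<close> is controlled by the modulars of \<open>f\<close> at radii at least \<open>r\<close>. This yields boundedness
  and the vanishing property at once.
\<close>

text \<open>\<open>f\<close> is only Lebesgue measurable, while exchanging integrals needs
  integrands that are Borel on the product. The estimates are therefore proved for nonnegative Borel
  functions \<open>u\<close> over \<open>lborel\<close> and reach \<open>f\<close> through a Borel
  representative of its norm. Potentials and maximal functions take values in
  \<open>ennreal\<close>, so they can be compared before anything is known to be finite; finiteness
  almost everywhere is then a consequence of the modular bound. With
  \<open>\<beta> = (n - l) / p\<close>, the hypothesis on \<open>q\<close> says exactly
  \<open>1 - a / \<beta> = p / q\<close>. This is why the \<open>q\<close>-th power of Hedberg's
  bound is the \<open>p\<close>-th power of the maximal function, up to a constant. Vanishing
  survives by locality: at points of a ball of radius \<open>r\<close>, averages over radii below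
  \<open>r\<close> only see \<open>f\<close> on the doubled ball, and averages over larger radii are
  controlled by the modulars at those radii. The Morrey norm, which does involve small radii, enters
  only as the fixed factor \<open>A powr (q - p)\<close>.\<close>

lemma ennreal_less_divide_iff:
  fixes x y z :: ennreal
  assumes "0 < z" "z < top"
  shows "x < y / z \<longleftrightarrow> x * z < y"
  using assms
  by (cases x; cases y; cases z)
     (auto simp: divide_ennreal ennreal_mult[symmetric] ennreal_less_iff field_simps
       ennreal_top_mult ennreal_top_divide)

lemma sets_borel_ball [measurable]: "ball (x :: 'a::metric_space) t \<in> sets borel"
  by simp

lemma emeasure_ball_powr:
  fixes x :: "'a::euclidean_space"
  assumes "0 < t"
  shows "emeasure lborel (ball x t) =
    ennreal (unit_ball_vol (real DIM('a)) * t powr real DIM('a))"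
  using assms by (simp add: emeasure_ball powr_realpow)

subsection \<open>Maximal functions\<close>

text \<open>With the normalisation \<open>\<phi>\<close> left open, one semicontinuity argument
  serves both the Hardy-Littlewood function, normalised here by \<open>t powr n\<close> instead of
  the volume, and the fractional maximal function.\<close>

definition maximal_fun ::
    "(real \<Rightarrow> real) \<Rightarrow> ('a::euclidean_space \<Rightarrow> real) \<Rightarrow> 'a \<Rightarrow> ennreal" where
  "maximal_fun \<phi> u x =
     (SUP t\<in>{0<..}. (\<integral>\<^sup>+y\<in>ball x t. ennreal (u y) \<partial>lborel) / ennreal (\<phi> t))"

abbreviation hl_max :: "('a::euclidean_space \<Rightarrow> real) \<Rightarrow> 'a \<Rightarrow> ennreal" where
  "hl_max \<equiv> maximal_fun (\<lambda>t. t powr real DIM('a))"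

lemma less_maximal_fun_iff:
  assumes "\<And>t. 0 < t \<Longrightarrow> 0 < \<phi> t"
  shows "c < maximal_fun \<phi> u x \<longleftrightarrow>
    (\<exists>t>0. c * ennreal (\<phi> t) < (\<integral>\<^sup>+y\<in>ball x t. ennreal (u y) \<partial>lborel))"
  using assms by (auto simp: maximal_fun_def less_SUP_iff ennreal_less_divide_iff)

lemma maximal_fun_upper:
  assumes "0 < t" "0 < \<phi> t"
  shows "(\<integral>\<^sup>+y\<in>ball x t. ennreal (u y) \<partial>lborel) \<le> maximal_fun \<phi> u x * ennreal (\<phi> t)"
proof -
  have "(\<integral>\<^sup>+y\<in>ball x t. ennreal (u y) \<partial>lborel) / ennreal (\<phi> t) \<le> maximal_fun \<phi> u x"
    unfolding maximal_fun_def by (rule SUP_upper) (use assms in auto)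
  then show ?thesis
    using ennreal_less_divide_iff[of "ennreal (\<phi> t)"] assms by (auto simp: not_less[symmetric])
qed

text \<open>Lower semicontinuity: a strict inequality at radius \<open>t\<close> persists at a
  slightly larger radius because \<open>\<phi>\<close> is continuous, and the enlarged ball about
  any nearby centre still contains the original ball. Borel measurability follows in spite of the
  supremum over uncountably many radii.\<close>

lemma open_less_maximal_fun:
  assumes cont: "continuous_on {0<..} \<phi>" and pos: "\<And>t. 0 < t \<Longrightarrow> 0 < \<phi> t"
  shows "open {x. c < maximal_fun \<phi> u x}"
  unfolding open_contains_ball
proof
  fix x assume "x \<in> {x. c < maximal_fun \<phi> u x}"
  then obtain t where t: "t > 0" "c * ennreal (\<phi> t) < (\<integral>\<^sup>+y\<in>ball x t. ennreal (u y) \<partial>lborel)"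
    using pos by (auto simp: less_maximal_fun_iff)
  \<comment> \<open>An infinite \<open>c\<close> would make the left side of the strict inequality
    infinite. Finiteness is what makes multiplication by \<open>c\<close> continuous below.\<close>
  have "c < top"
    using t pos[of t] by (cases "c = top") (auto simp: ennreal_top_mult less_top[symmetric])
  have "isCont \<phi> t"
    using cont t(1) by (simp add: continuous_on_eq_continuous_at)
  then have "((\<lambda>s. c * ennreal (\<phi> s)) \<longlongrightarrow> c * ennreal (\<phi> t)) (at t)"
    using \<open>c < top\<close> by (intro ennreal_tendsto_cmult tendsto_ennrealI) (auto simp: isCont_def)
  then have "eventually (\<lambda>s. c * ennreal (\<phi> s) < (\<integral>\<^sup>+y\<in>ball x t. ennreal (u y) \<partial>lborel)) (at t)"
    using t(2) by (rule order_tendstoD)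
  then obtain d where d: "d > 0"
    "\<And>s. dist s t < d \<Longrightarrow> s \<noteq> t \<Longrightarrow> c * ennreal (\<phi> s) < (\<integral>\<^sup>+y\<in>ball x t. ennreal (u y) \<partial>lborel)"
    by (auto simp: eventually_at)
  have "ball x (d / 2) \<subseteq> {x. c < maximal_fun \<phi> u x}"
  proof
    fix z assume z: "z \<in> ball x (d / 2)"
    have "c * ennreal (\<phi> (t + d / 2)) < (\<integral>\<^sup>+y\<in>ball x t. ennreal (u y) \<partial>lborel)"
      using d by (intro d(2)) (auto simp: dist_real_def)
    also have "\<dots> \<le> (\<integral>\<^sup>+y\<in>ball z (t + d / 2). ennreal (u y) \<partial>lborel)"
    proof (intro nn_integral_mono mult_left_mono)
      fix y
      have "y \<in> ball z (t + d / 2)" if "y \<in> ball x t"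
        using that z dist_triangle[of z y x] by (auto simp: dist_commute)
      then show "indicator (ball x t) y \<le> (indicator (ball z (t + d / 2)) y :: ennreal)"
        by (auto simp: indicator_def)
    qed auto
    finally have "\<exists>s>0. c * ennreal (\<phi> s) < (\<integral>\<^sup>+y\<in>ball z s. ennreal (u y) \<partial>lborel)"
      using t(1) d(1) by (intro exI[of _ "t + d / 2"]) simp
    then show "z \<in> {x. c < maximal_fun \<phi> u x}"
      by (simp add: less_maximal_fun_iff pos)
  qed
  then show "\<exists>e>0. ball x e \<subseteq> {x. c < maximal_fun \<phi> u x}"
    using d(1) by (intro exI[of _ "d / 2"]) auto
qed

lemma borel_measurable_maximal_fun:
  assumes "continuous_on {0<..} \<phi>" "\<And>t. 0 < t \<Longrightarrow> 0 < \<phi> t"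
  shows "maximal_fun \<phi> u \<in> borel_measurable borel"
  by (rule borel_measurableI_greater) (simp add: open_less_maximal_fun assms)

lemma borel_measurable_hl_max [measurable]: "hl_max u \<in> borel_measurable borel"
  by (intro borel_measurable_maximal_fun continuous_intros) auto

text \<open>Every point of the level set is the centre of a ball of radius \<open>t\<close> carrying
  mass more than \<open>s * t powr n\<close>. Vitali selects disjoint balls among these whose 5-fold
  dilates still cover; dilation costs \<open>5 powr n\<close>, and disjointness bounds the total
  mass by the full integral.\<close>

lemma hl_max_weak_type:
  fixes u :: "'a::euclidean_space \<Rightarrow> real"
  assumes u [measurable]: "u \<in> borel_measurable borel" and s: "0 < s"
  shows "ennreal s * emeasure lborel {x. ennreal s < hl_max u x} \<le>
    ennreal (unit_ball_vol (real DIM('a)) * 5 powr real DIM('a)) * (\<integral>\<^sup>+y. ennreal (u y) \<partial>lborel)"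
    (is "_ \<le> ennreal (?V * ?c) * ?I")
proof (cases "?I = top")
  case True
  then show ?thesis using unit_ball_vol_pos[of "real DIM('a)"] by (auto simp: ennreal_mult_top simp del: unit_ball_vol_pos)
next
  case False
  define E where "E = {x. ennreal s < hl_max u x}"
  define n where "n = real DIM('a)"
  have n: "n > 0" by (simp add: n_def)
  have E[measurable]: "E \<in> sets borel" unfolding E_def by measurable
  define I where "I = enn2real ?I"
  have I: "?I = ennreal I" "I \<ge> 0" using False by (auto simp: I_def less_top)
  have "\<forall>x\<in>E. \<exists>t>0. ennreal (s * t powr n) < (\<integral>\<^sup>+y\<in>ball x t. ennreal (u y) \<partial>lborel)"
    using s by (simp add: E_def less_maximal_fun_iff n_def ennreal_mult)
  then obtain t where t: "\<And>x. x \<in> E \<Longrightarrow> t x > 0"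
    "\<And>x. x \<in> E \<Longrightarrow> ennreal (s * t x powr n) < (\<integral>\<^sup>+y\<in>ball x (t x). ennreal (u y) \<partial>lborel)"
    unfolding bchoice_iff by blast
  \<comment> \<open>The covering lemma needs bounded radii. They are bounded because the mass of
    each ball is at most the total \<open>I\<close>, which is finite in this case.\<close>
  have bound: "t x \<le> (I / s) powr (1 / n)" if "x \<in> E" for x
  proof -
    have "(\<integral>\<^sup>+y\<in>ball x (t x). ennreal (u y) \<partial>lborel) \<le> ?I"
      by (intro nn_integral_mono) (auto simp: indicator_def)
    then have "ennreal (s * t x powr n) < ennreal I"
      using t(2)[OF that] I by simp
    then have "t x powr n \<le> I / s"
      using s by (simp add: ennreal_less_iff field_simps)
    then have "(t x powr n) powr (1 / n) \<le> (I / s) powr (1 / n)"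
      using n by (intro powr_mono2) auto
    then show ?thesis
      using n t(1)[OF that] by (simp add: powr_powr)
  qed
  obtain C where C: "countable C" "C \<subseteq> E"
    and disj: "pairwise (\<lambda>i j. disjnt (ball i (t i)) (ball j (t j))) C"
    and cov: "E \<subseteq> (\<Union>i\<in>C. ball i (5 * t i))"
  proof (rule Vitali_covering_lemma_balls[where S = E and K = E and a = "\<lambda>x. x" and r = t])
    show "E \<subseteq> (\<Union>i\<in>E. ball i (t i))" using t(1) by force
    show "0 < t i \<and> t i \<le> (I / s) powr (1 / n)" if "i \<in> E" for i
      using t(1) bound that by blast
  qed
  have "ennreal s * emeasure lborel E = ennreal s * (\<integral>\<^sup>+x. indicator E x \<partial>lborel)"
    by simp
  \<comment> \<open>Countable subadditivity in integral form: the indicator of a union is at most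
    the sum of the indicators, and the sum is an integral over a counting measure that can be
    exchanged with the outer one.\<close>
  also have "\<dots> \<le> ennreal s * (\<integral>\<^sup>+x. \<integral>\<^sup>+i. indicator (ball i (5 * t i)) x \<partial>count_space C \<partial>lborel)"
  proof (intro mult_left_mono nn_integral_mono)
    fix x
    show "indicator E x \<le> (\<integral>\<^sup>+i. indicator (ball i (5 * t i)) x \<partial>count_space C)"
    proof (cases "x \<in> E")
      case True
      with cov obtain i where i: "i \<in> C" "x \<in> ball i (5 * t i)" by auto
      have "1 \<le> (\<integral>\<^sup>+j. indicator {i} j \<partial>count_space C)"
        using i by simp
      also have "\<dots> \<le> (\<integral>\<^sup>+i. indicator (ball i (5 * t i)) x \<partial>count_space C)"
        using i by (intro nn_integral_mono) (auto simp: indicator_def)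
      finally show ?thesis using True by simp
    qed simp
  qed auto
  also have "\<dots> = ennreal s * (\<integral>\<^sup>+i. emeasure lborel (ball i (5 * t i)) \<partial>count_space C)"
    using C(1) by (subst nn_integral_count_space_nn_integral) (auto intro!: borel_measurable_indicator)
  also have "\<dots> = (\<integral>\<^sup>+i. ennreal s * emeasure lborel (ball i (5 * t i)) \<partial>count_space C)"
    by (simp add: nn_integral_cmult)
  also have "\<dots> \<le> (\<integral>\<^sup>+i. ennreal (?V * ?c) * emeasure (density lborel u) (ball i (t i)) \<partial>count_space C)"
  proof (intro nn_integral_mono)
    fix i assume "i \<in> space (count_space C)"
    then have i: "i \<in> E" using C by auto
    have "ennreal s * emeasure lborel (ball i (5 * t i)) = ennreal (?V * ?c) * ennreal (s * t i powr n)"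
      using t(1)[OF i] s
      by (simp add: emeasure_ball_powr powr_mult n_def ennreal_mult[symmetric] mult_ac)
    also have "\<dots> \<le> ennreal (?V * ?c) * emeasure (density lborel u) (ball i (t i))"
      using t(2)[OF i] by (intro mult_left_mono) (auto simp: emeasure_density)
    finally show "ennreal s * emeasure lborel (ball i (5 * t i)) \<le> \<dots>" .
  qed
  also have "\<dots> = ennreal (?V * ?c) * emeasure (density lborel u) (\<Union>i\<in>C. ball i (t i))"
  proof -
    have "disjoint_family_on (\<lambda>i. ball i (t i)) C"
      using disj by (auto simp: disjoint_family_on_def pairwise_def disjnt_def)
    then show ?thesis
      using C(1) by (subst emeasure_UN_countable) (auto simp: nn_integral_cmult)
  qed
  also have "\<dots> \<le> ennreal (?V * ?c) * ?I"
  proof (intro mult_left_mono)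
    have "(\<Union>i\<in>C. ball i (t i)) \<in> sets borel" by (intro borel_open) auto
    then show "emeasure (density lborel u) (\<Union>i\<in>C. ball i (t i)) \<le> ?I"
      by (auto simp: emeasure_density intro!: nn_integral_mono split: split_indicator)
  qed auto
  finally show ?thesis unfolding E_def .
qed

subsection \<open>Powers of extended nonnegative reals\<close>

text \<open>\<open>enn2real\<close> sends \<open>top\<close> to 0, hence the separate case; it keeps
  the power monotone up to \<open>top\<close> for nonnegative exponents.\<close>

definition ennpow :: "real \<Rightarrow> ennreal \<Rightarrow> ennreal" where
  "ennpow p z = (if z = top then top else ennreal (enn2real z powr p))"

lemma ennpow_ennreal: "0 \<le> c \<Longrightarrow> ennpow p (ennreal c) = ennreal (c powr p)"
  by (simp add: ennpow_def)

lemma ennpow_top [simp]: "ennpow p top = top"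
  by (simp add: ennpow_def)

lemma ennpow_0 [simp]: "ennpow p 0 = 0"
  by (simp add: ennpow_def)

lemma ennpow_mono:
  assumes "0 \<le> p" "x \<le> y"
  shows "ennpow p x \<le> ennpow p y"
  using assms by (cases x; cases y) (auto simp: ennpow_ennreal top_unique intro!: powr_mono2)

lemma ennpow_cmult:
  assumes "0 < c"
  shows "ennpow p (ennreal c * z) = ennreal (c powr p) * ennpow p z"
  using assms
  by (cases z) (auto simp: ennpow_ennreal ennreal_mult[symmetric] powr_mult ennreal_mult_top)

lemma ennpow_max: "ennpow p (max x y) \<le> ennpow p x + ennpow p y"
  by (auto simp: max_def)

lemma borel_measurable_ennpow [measurable]: "ennpow p \<in> borel_measurable borel"
  unfolding ennpow_def[abs_def] by measurable

lemma nn_integral_powr_from_0: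
  assumes "0 < p" "0 \<le> c"
  shows "(\<integral>\<^sup>+s. ennreal (p * s powr (p - 1)) * indicator {0..c} s \<partial>lborel) = ennreal (c powr p)"
proof -
  have "((\<lambda>s. p * s powr (p - 1)) has_integral (p * (c powr (p - 1 + 1) / (p - 1 + 1)))) {0..c}"
    using assms by (intro has_integral_mult_right has_integral_powr_from_0) auto
  then show ?thesis
    using assms by (subst nn_integral_has_integral_lebesgue') auto
qed

lemma nn_integral_powr_to_inf:
  assumes "0 < p" "0 < c"
  shows "(\<integral>\<^sup>+s. ennreal (p * s powr (- p - 1)) * indicator {c..} s \<partial>lborel) =
    ennreal (c powr - p)"
proof -
  have "((\<lambda>s. p * s powr (- p - 1)) has_integral
      (p * (- (c powr (- p - 1 + 1)) / (- p - 1 + 1)))) {c..}"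
    using assms by (intro has_integral_mult_right has_integral_powr_to_inf) auto
  then show ?thesis
    using assms by (subst nn_integral_has_integral_lebesgue') auto
qed

text \<open>The power is the integral of its derivative over the levels below \<open>z\<close>.
  Integrated over a space and combined with Tonelli, this turns bounds on level sets into bounds on
  \<open>p\<close>-th powers. The guard \<open>0 < s\<close> excludes negative levels, where
  \<open>ennreal s\<close> is 0.\<close>

lemma ennpow_layer_cake:
  assumes p: "0 < p"
  shows "ennpow p z =
    (\<integral>\<^sup>+s. (if 0 < s \<and> ennreal s < z then ennreal (p * s powr (p - 1)) else 0) \<partial>lborel)"
proof (cases z)
  case (real c)
  have "(\<integral>\<^sup>+s. (if 0 < s \<and> ennreal s < z then ennreal (p * s powr (p - 1)) else 0) \<partial>lborel) =
    (\<integral>\<^sup>+s. ennreal (p * s powr (p - 1)) * indicator {0..c} s \<partial>lborel)"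
  proof (rule nn_integral_cong_AE)
    show "AE s in lborel. (if 0 < s \<and> ennreal s < z then ennreal (p * s powr (p - 1)) else 0) =
      ennreal (p * s powr (p - 1)) * indicator {0..c} s"
      using AE_lborel_singleton[of c] AE_lborel_singleton[of 0]
      by eventually_elim (use real in \<open>auto simp: ennreal_less_iff indicator_def\<close>)
  qed
  then show ?thesis
    using real p by (simp add: nn_integral_powr_from_0 ennpow_ennreal)
next
  case top
  let ?I = "\<integral>\<^sup>+s. (if 0 < s \<and> ennreal s < z then ennreal (p * s powr (p - 1)) else 0) \<partial>lborel"
  have "ennreal (c powr p) \<le> ?I" if "0 \<le> c" for c
  proof -
    have "ennreal (c powr p) = (\<integral>\<^sup>+s. ennreal (p * s powr (p - 1)) * indicator {0..c} s \<partial>lborel)"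
      using that p by (simp add: nn_integral_powr_from_0)
    also have "\<dots> \<le> ?I"
    proof (rule nn_integral_mono_AE)
      show "AE s in lborel. ennreal (p * s powr (p - 1)) * indicator {0..c} s \<le>
          (if 0 < s \<and> ennreal s < z then ennreal (p * s powr (p - 1)) else 0)"
        using AE_lborel_singleton[of 0]
        by eventually_elim (use top in \<open>auto simp: indicator_def\<close>)
    qed
    finally show ?thesis .
  qed
  note le = this
  have "?I = top"
  proof (rule ccontr)
    assume "?I \<noteq> top"
    then obtain r where r: "?I = ennreal r" "0 \<le> r" by (cases ?I) auto
    have "ennreal (((r + 1) powr (1 / p)) powr p) \<le> ennreal r"
      using le[of "(r + 1) powr (1 / p)"] r by simp
    then show False using r p by (simp add: powr_powr)
  qed
  then show ?thesis using top by simp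
qed

subsection \<open>The maximal theorem\<close>

text \<open>The part of \<open>u\<close> with values at most \<open>s / (2 * V)\<close> contributes
  at most \<open>s / 2\<close> to every average, since a ball has volume
  \<open>V * t powr n\<close>. So where the maximal function exceeds \<open>s\<close>, that of the
  remaining large part \<open>w\<close> exceeds \<open>s / 2\<close>, and the weak-type bound is
  applied to \<open>w\<close> alone.\<close>

lemma hl_max_weak_type_truncated:
  fixes u :: "'a::euclidean_space \<Rightarrow> real"
  assumes u [measurable]: "u \<in> borel_measurable borel" and u0: "\<And>y. 0 \<le> u y" and s: "0 < s"
  defines "V \<equiv> unit_ball_vol (real DIM('a))"
  shows "ennreal s * emeasure lborel {x. ennreal s < hl_max u x} \<le>
    ennreal (2 * V * 5 powr real DIM('a)) *
      (\<integral>\<^sup>+y. (if s < 2 * V * u y then ennreal (u y) else 0) \<partial>lborel)"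
proof -
  have V: "V > 0" by (simp add: V_def)
  define n where "n = real DIM('a)"
  define w where "w y = (if s < 2 * V * u y then u y else 0)" for y
  have w[measurable]: "w \<in> borel_measurable borel" unfolding w_def by measurable
  have "{x. ennreal s < hl_max u x} \<subseteq> {x. ennreal (s / 2) < hl_max w x}"
  proof safe
    fix x assume "ennreal s < hl_max u x"
    then obtain t where t: "t > 0"
      "ennreal s * ennreal (t powr n) < (\<integral>\<^sup>+y\<in>ball x t. ennreal (u y) \<partial>lborel)"
      by (auto simp: less_maximal_fun_iff n_def)
    have "(\<integral>\<^sup>+y\<in>ball x t. ennreal (u y) \<partial>lborel) \<le>
      (\<integral>\<^sup>+y. ennreal (w y) * indicator (ball x t) y + ennreal (s / (2 * V)) * indicator (ball x t) y \<partial>lborel)"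
      using V s u0 by (intro nn_integral_mono)
        (auto simp: w_def indicator_def field_simps not_less intro!: ennreal_leI)
    also have "\<dots> = (\<integral>\<^sup>+y\<in>ball x t. ennreal (w y) \<partial>lborel) + ennreal (s / (2 * V)) * emeasure lborel (ball x t)"
      by (subst nn_integral_add) (auto simp: nn_integral_cmult_indicator)
    also have "ennreal (s / (2 * V)) * emeasure lborel (ball x t) = ennreal (s / 2 * t powr n)"
      using t V s by (simp add: emeasure_ball_powr V_def[symmetric] n_def ennreal_mult[symmetric])
    finally have *: "ennreal (s * t powr n) <
        (\<integral>\<^sup>+y\<in>ball x t. ennreal (w y) \<partial>lborel) + ennreal (s / 2 * t powr n)"
      using t s by (simp add: ennreal_mult)
    have "ennreal (s / 2 * t powr n) < (\<integral>\<^sup>+y\<in>ball x t. ennreal (w y) \<partial>lborel)"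
    proof (rule ccontr)
      assume "\<not> ?thesis"
      then have "(\<integral>\<^sup>+y\<in>ball x t. ennreal (w y) \<partial>lborel) + ennreal (s / 2 * t powr n) \<le>
        ennreal (s / 2 * t powr n) + ennreal (s / 2 * t powr n)"
        by (intro add_right_mono) auto
      also have "\<dots> = ennreal (s * t powr n)"
        using s by (simp flip: ennreal_plus)
      finally show False using * by auto
    qed
    then show "ennreal (s / 2) < hl_max w x"
      using t(1) s by (auto simp: less_maximal_fun_iff n_def ennreal_mult[symmetric])
  qed
  then have "ennreal s * emeasure lborel {x. ennreal s < hl_max u x} \<le>
    ennreal s * emeasure lborel {x. ennreal (s / 2) < hl_max w x}"
    by (intro mult_left_mono emeasure_mono) auto
  also have "\<dots> = 2 * (ennreal (s / 2) * emeasure lborel {x. ennreal (s / 2) < hl_max w x})"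
    using s by (simp add: mult.assoc[symmetric] ennreal_mult[symmetric] flip: ennreal_numeral)
  also have "\<dots> \<le> 2 * (ennreal (V * 5 powr real DIM('a)) * (\<integral>\<^sup>+y. ennreal (w y) \<partial>lborel))"
    unfolding V_def using s by (intro mult_left_mono hl_max_weak_type w) auto
  also have "\<dots> = ennreal (2 * V * 5 powr real DIM('a)) * (\<integral>\<^sup>+y. ennreal (w y) \<partial>lborel)"
    using V by (simp add: ennreal_mult mult.assoc)
  also have "(\<lambda>y. ennreal (w y)) = (\<lambda>y. if s < 2 * V * u y then ennreal (u y) else 0)"
    by (auto simp: w_def)
  finally show ?thesis .
qed

text \<open>Marcinkiewicz interpolation between the weak-type bound and the trivial sup bound, both
  packed into the truncated estimate. After Tonelli the level integral at \<open>y\<close> is that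
  of \<open>s powr (p - 2)\<close> up to \<open>2 * V * u y\<close>, which converges at 0 because
  \<open>p > 1\<close>.\<close>

lemma hl_max_strong_type:
  assumes p: "1 < p"
  obtains C where "0 \<le> C"
    "\<And>u :: 'a::euclidean_space \<Rightarrow> real. u \<in> borel_measurable borel \<Longrightarrow> (\<And>y. 0 \<le> u y) \<Longrightarrow>
      (\<integral>\<^sup>+x. ennpow p (hl_max u x) \<partial>lborel) \<le> ennreal C * (\<integral>\<^sup>+y. ennreal (u y powr p) \<partial>lborel)"
proof -
  define V where "V = unit_ball_vol (real DIM('a))"
  have V: "V > 0" by (simp add: V_def)
  define W where "W = 2 * V * 5 powr real DIM('a)"
  have W: "W > 0" using V by (simp add: W_def)
  \<comment> \<open>\<open>W\<close> is the truncated weak-type constant, \<open>p\<close> comes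
    from the layer cake, and integrating \<open>s powr (p - 2)\<close> up to
    \<open>2 * V * u y\<close> gives the other two factors.\<close>
  define C where "C = W * p / (p - 1) * (2 * V) powr (p - 1)"
  have C: "C \<ge> 0" using W p V by (auto simp: C_def)
  have "(\<integral>\<^sup>+x. ennpow p (hl_max u x) \<partial>lborel) \<le> ennreal C * (\<integral>\<^sup>+y. ennreal (u y powr p) \<partial>lborel)"
    if u[measurable]: "u \<in> borel_measurable borel" and u0: "\<And>y. 0 \<le> u y" for u :: "'a \<Rightarrow> real"
  proof -
    have "(\<integral>\<^sup>+x. ennpow p (hl_max u x) \<partial>lborel) = (\<integral>\<^sup>+x. \<integral>\<^sup>+s. (if 0 < s \<and> ennreal s < hl_max u x then
        ennreal (p * s powr (p - 1)) else 0) \<partial>lborel \<partial>lborel)"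
      using p by (intro nn_integral_cong ennpow_layer_cake) auto
    also have "\<dots> = (\<integral>\<^sup>+s. \<integral>\<^sup>+x. (if 0 < s \<and> ennreal s < hl_max u x then
        ennreal (p * s powr (p - 1)) else 0) \<partial>lborel \<partial>lborel)"
      by (rule lborel_pair.Fubini') measurable
    also have "\<dots> \<le> (\<integral>\<^sup>+s. \<integral>\<^sup>+y. (if 0 < s \<and> s < 2 * V * u y then
        ennreal (W * p * s powr (p - 2) * u y) else 0) \<partial>lborel \<partial>lborel)"
    proof (rule nn_integral_mono)
      fix s :: real
      show "(\<integral>\<^sup>+x. (if 0 < s \<and> ennreal s < hl_max u x then
          ennreal (p * s powr (p - 1)) else 0) \<partial>lborel) \<le>
        (\<integral>\<^sup>+y. (if 0 < s \<and> s < 2 * V * u y then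
          ennreal (W * p * s powr (p - 2) * u y) else 0) \<partial>lborel)"
      proof (cases "s > 0")
        case True
        have "(\<integral>\<^sup>+x. (if 0 < s \<and> ennreal s < hl_max u x then ennreal (p * s powr (p - 1)) else 0) \<partial>lborel)
          = (\<integral>\<^sup>+x. ennreal (p * s powr (p - 1)) * indicator {x. ennreal s < hl_max u x} x \<partial>lborel)"
          using True by (intro nn_integral_cong) auto
        also have "\<dots> = ennreal (p * s powr (p - 1)) * emeasure lborel {x. ennreal s < hl_max u x}"
          by (subst nn_integral_cmult_indicator) auto
        \<comment> \<open>One factor \<open>s\<close> is split off to form the left side of the
          weak-type bound.\<close>
        also have "\<dots> = ennreal (p * s powr (p - 2) * s) * emeasure lborel {x. ennreal s < hl_max u x}"
          using True powr_add[of s "p - 2" 1] by (simp add: mult.assoc)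
        also have "ennreal (p * s powr (p - 2) * s) * emeasure lborel {x. ennreal s < hl_max u x} =
          ennreal (p * s powr (p - 2)) * (ennreal s * emeasure lborel {x. ennreal s < hl_max u x})"
          using True p by (simp add: ennreal_mult mult.assoc)
        also have "\<dots> \<le> ennreal (p * s powr (p - 2)) *
          (ennreal W * (\<integral>\<^sup>+y. (if s < 2 * V * u y then ennreal (u y) else 0) \<partial>lborel))"
          unfolding W_def V_def using True
          by (intro mult_left_mono hl_max_weak_type_truncated u u0) auto
        also have "\<dots> = (\<integral>\<^sup>+y. ennreal (p * s powr (p - 2)) * (ennreal W *
            (if s < 2 * V * u y then ennreal (u y) else 0)) \<partial>lborel)"
          by (simp add: nn_integral_cmult)
        also have "\<dots> = (\<integral>\<^sup>+y. (if 0 < s \<and> s < 2 * V * u y then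
            ennreal (W * p * s powr (p - 2) * u y) else 0) \<partial>lborel)"
          using True p W u0 by (intro nn_integral_cong) (auto simp: ennreal_mult[symmetric] mult_ac)
        finally show ?thesis .
      qed simp
    qed
    also have "\<dots> = (\<integral>\<^sup>+y. \<integral>\<^sup>+s. (if 0 < s \<and> s < 2 * V * u y then
        ennreal (W * p * s powr (p - 2) * u y) else 0) \<partial>lborel \<partial>lborel)"
      by (rule lborel_pair.Fubini') measurable
    also have "\<dots> = (\<integral>\<^sup>+y. ennreal C * ennreal (u y powr p) \<partial>lborel)"
    proof (rule nn_integral_cong)
      fix y
      define c where "c = W * p / (p - 1) * u y"
      have c: "c \<ge> 0" using W p u0[of y] by (auto simp: c_def)
      \<comment> \<open>The level integral is brought into the shape of the layer cake with exponent
        \<open>p - 1\<close>, which is then read backwards.\<close>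
      have "(\<integral>\<^sup>+s. (if 0 < s \<and> s < 2 * V * u y then
          ennreal (W * p * s powr (p - 2) * u y) else 0) \<partial>lborel) =
        (\<integral>\<^sup>+s. ennreal c * (if 0 < s \<and> ennreal s < ennreal (2 * V * u y) then
          ennreal ((p - 1) * s powr (p - 1 - 1)) else 0) \<partial>lborel)"
        using p c V u0[of y]
        by (intro nn_integral_cong) (auto simp: c_def ennreal_less_iff ennreal_mult[symmetric] mult_ac)
      also have "\<dots> = ennreal c * ennpow (p - 1) (ennreal (2 * V * u y))"
        using p by (subst nn_integral_cmult) (auto simp: ennpow_layer_cake)
      also have "\<dots> = ennreal (c * (2 * V * u y) powr (p - 1))"
        using V c u0[of y] by (subst ennpow_ennreal) (auto simp: ennreal_mult)
      also have "c * (2 * V * u y) powr (p - 1) = C * u y powr p"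
        using V u0[of y] powr_add[of "u y" "p - 1" 1] by (cases "u y = 0") (auto simp: c_def C_def powr_mult)
      finally show "(\<integral>\<^sup>+s. (if 0 < s \<and> s < 2 * V * u y then
          ennreal (W * p * s powr (p - 2) * u y) else 0) \<partial>lborel) = ennreal C * ennreal (u y powr p)"
        using C by (simp add: ennreal_mult)
    qed
    also have "\<dots> = ennreal C * (\<integral>\<^sup>+y. ennreal (u y powr p) \<partial>lborel)"
      by (rule nn_integral_cmult) measurable
    finally show ?thesis .
  qed
  with C show ?thesis by (rule that)
qed

subsection \<open>Morrey bounds for the maximal function\<close>

text \<open>A substitute for Hoelder's inequality: \<open>u \<le> s + s powr (1 - p) * u powr p\<close> for every level
  \<open>s\<close>, which is then chosen to balance both terms.\<close>

lemma nn_integral_ball_le_of_morrey: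
  fixes u :: "'a::euclidean_space \<Rightarrow> real"
  assumes u [measurable]: "u \<in> borel_measurable borel" and u0: "\<And>y. 0 \<le> u y"
    and p: "1 < p" and B: "0 < B" and t: "0 < t"
    and M: "(\<integral>\<^sup>+y\<in>ball x t. ennreal (u y powr p) \<partial>lborel) \<le> ennreal (B * t powr l)"
  shows "(\<integral>\<^sup>+y\<in>ball x t. ennreal (u y) \<partial>lborel) \<le>
    ennreal ((unit_ball_vol (real DIM('a)) + 1) * B powr (1 / p) *
      t powr (real DIM('a) + (l - real DIM('a)) / p))"
proof -
  define n where "n = real DIM('a)"
  define V where "V = unit_ball_vol n"
  have V: "V > 0" by (simp add: V_def n_def)
  \<comment> \<open>This level solves \<open>s powr p * t powr n = B * t powr l\<close>, so
    \<open>s * t powr n\<close> and \<open>s powr (1 - p) * B * t powr l\<close> coincide.\<close>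
  define s where "s = B powr (1 / p) * t powr ((l - n) / p)"
  have s: "s > 0" using B t by (simp add: s_def)
  have sp: "s powr (1 - p) = B powr (1 / p - 1) * t powr ((l - n) / p - (l - n))"
    using B t p by (simp add: s_def powr_mult powr_powr field_simps)
  have "u y \<le> s + s powr (1 - p) * u y powr p" for y
  proof (cases "u y \<le> s")
    case False
    then have "u y powr (1 - p) * u y powr p \<le> s powr (1 - p) * u y powr p"
      using s p by (intro mult_right_mono powr_mono2') auto
    moreover have "u y powr (1 - p) * u y powr p = u y"
      using False s by (simp flip: powr_add)
    ultimately show ?thesis using s by simp
  qed (simp add: add_increasing2)
  then have "(\<integral>\<^sup>+y\<in>ball x t. ennreal (u y) \<partial>lborel) \<le>
    (\<integral>\<^sup>+y. ennreal s * indicator (ball x t) y +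
      ennreal (s powr (1 - p)) * (ennreal (u y powr p) * indicator (ball x t) y) \<partial>lborel)"
    using s by (intro nn_integral_mono)
      (auto simp: indicator_def ennreal_mult[symmetric] ennreal_plus[symmetric] simp del: ennreal_plus
        intro!: ennreal_leI)
  also have "\<dots> = ennreal s * emeasure lborel (ball x t) +
      ennreal (s powr (1 - p)) * (\<integral>\<^sup>+y\<in>ball x t. ennreal (u y powr p) \<partial>lborel)"
    by (subst nn_integral_add) (auto simp: nn_integral_cmult_indicator nn_integral_cmult)
  also have "\<dots> \<le> ennreal s * ennreal (V * t powr n) + ennreal (s powr (1 - p)) * ennreal (B * t powr l)"
    using t M by (intro add_mono mult_left_mono) (auto simp: emeasure_ball_powr V_def n_def)
  also have "\<dots> = ennreal (s * V * t powr n + s powr (1 - p) * B * t powr l)"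
    using s V B by (simp add: ennreal_mult[symmetric] ennreal_plus[symmetric] mult.assoc del: ennreal_plus)
  also have "s * V * t powr n = V * B powr (1 / p) * t powr (n + (l - n) / p)"
    by (simp add: s_def powr_add)
  also have "s powr (1 - p) * B * t powr l = B powr (1 / p) * t powr (n + (l - n) / p)"
  proof -
    have "B powr (1 / p - 1) * B = B powr (1 / p)"
      using B powr_add[of B "1 / p - 1" 1] by simp
    moreover have "t powr ((l - n) / p - (l - n)) * t powr l = t powr (n + (l - n) / p)"
      by (simp add: add.commute flip: powr_add)
    ultimately show ?thesis unfolding sp by (metis (no_types, lifting) mult.assoc mult.commute)
  qed
  also have "V * B powr (1 / p) * t powr (n + (l - n) / p) + B powr (1 / p) * t powr (n + (l - n) / p) =
      (V + 1) * B powr (1 / p) * t powr (n + (l - n) / p)"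
    by (simp add: algebra_simps)
  finally show ?thesis by (simp add: V_def n_def)
qed

text \<open>The Morrey condition is only required at radii at least \<open>r\<close>, so that the bound also
  transfers the vanishing property.\<close>

lemma hl_max_morrey_bound:
  assumes p: "1 < p" and l: "0 \<le> l" "l \<le> real DIM('a)"
  obtains C where "0 < C"
    "\<And>(u :: 'a::euclidean_space \<Rightarrow> real) x r B.
      u \<in> borel_measurable borel \<Longrightarrow> (\<And>y. 0 \<le> u y) \<Longrightarrow> 0 < r \<Longrightarrow> 0 < B \<Longrightarrow>
      (\<And>z t. r \<le> t \<Longrightarrow> (\<integral>\<^sup>+y\<in>ball z t. ennreal (u y powr p) \<partial>lborel) \<le> ennreal (B * t powr l)) \<Longrightarrow>
      (\<integral>\<^sup>+z\<in>ball x r. ennpow p (hl_max u z) \<partial>lborel) \<le> ennreal (C * B * r powr l)"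
proof -
  obtain C0 where C0: "0 \<le> C0"
    "\<And>u :: 'a \<Rightarrow> real. u \<in> borel_measurable borel \<Longrightarrow> (\<And>y. 0 \<le> u y) \<Longrightarrow>
      (\<integral>\<^sup>+x. ennpow p (hl_max u x) \<partial>lborel) \<le> ennreal C0 * (\<integral>\<^sup>+y. ennreal (u y powr p) \<partial>lborel)"
    using hl_max_strong_type[OF p] by blast
  define n where "n = real DIM('a)"
  define V where "V = unit_ball_vol n"
  have V: "V > 0" by (simp add: V_def n_def)
  \<comment> \<open>The first summand is the strong-type bound for the local part on the ball of
    radius \<open>2 * r\<close>; the second is \<open>D powr p\<close> times the volume of the ball
    of radius \<open>r\<close>.\<close>
  define C where "C = C0 * 2 powr l + (V + 1) powr p * V"
  have C: "C > 0" using C0 V by (auto simp: C_def intro!: add_nonneg_pos)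
  have "(\<integral>\<^sup>+z\<in>ball x r. ennpow p (hl_max u z) \<partial>lborel) \<le> ennreal (C * B * r powr l)"
    if u[measurable]: "u \<in> borel_measurable borel" and u0: "\<And>y. 0 \<le> u y" and r: "0 < r" and B: "0 < B"
      and M: "\<And>z t. r \<le> t \<Longrightarrow> (\<integral>\<^sup>+y\<in>ball z t. ennreal (u y powr p) \<partial>lborel) \<le> ennreal (B * t powr l)"
    for u :: "'a \<Rightarrow> real" and x r B
  proof -
    \<comment> \<open>For a centre in \<open>ball x r\<close> and a radius below \<open>r\<close>,
      the averaging ball stays inside \<open>ball x (2 * r)\<close>, so there \<open>u\<close> may
      be replaced by \<open>w\<close>.\<close>
    define w where "w y = u y * indicator (ball x (2 * r)) y" for y
    have w[measurable]: "w \<in> borel_measurable borel" unfolding w_def by measurable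
    \<comment> \<open>A bound for all averages over radii \<open>t\<close> at least
      \<open>r\<close>: they are at most
      \<open>(V + 1) * B powr (1 / p) * t powr ((l - n) / p)\<close>, which is largest at
      \<open>t = r\<close> because \<open>l \<le> n\<close>.\<close>
    define D where "D = (V + 1) * B powr (1 / p) * r powr ((l - n) / p)"
    have D: "D \<ge> 0" using V by (simp add: D_def)
    have le: "hl_max u z \<le> max (hl_max w z) (ennreal D)" if z: "z \<in> ball x r" for z
      unfolding maximal_fun_def[of _ u]
    proof (rule SUP_least)
      fix t :: real assume "t \<in> {0<..}"
      then have t: "t > 0" by simp
      show "(\<integral>\<^sup>+y\<in>ball z t. ennreal (u y) \<partial>lborel) / ennreal (t powr real DIM('a)) \<le> max (hl_max w z) (ennreal D)"
      proof (cases "r \<le> t")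
        case True
        have "(\<integral>\<^sup>+y\<in>ball z t. ennreal (u y) \<partial>lborel) \<le>
            ennreal ((V + 1) * B powr (1 / p) * t powr (n + (l - n) / p))"
          unfolding V_def n_def
          by (rule nn_integral_ball_le_of_morrey[OF u u0 p B t M[OF True]])
        also have "\<dots> \<le> ennreal (t powr n * D)"
        proof (rule ennreal_leI)
          have "t powr ((l - n) / p) \<le> r powr ((l - n) / p)"
            using True r p l by (intro powr_mono2') (auto simp: n_def divide_nonpos_pos)
          then show "(V + 1) * B powr (1 / p) * t powr (n + (l - n) / p) \<le> t powr n * D"
            using V by (simp add: D_def powr_add mult_left_mono mult.left_commute[of _ "t powr n"])
        qed
        finally show ?thesis
          using t D by (intro max.coboundedI2 divide_le_posI_ennreal) (auto simp: ennreal_mult n_def)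
      next
        case False
        have "(\<integral>\<^sup>+y\<in>ball z t. ennreal (u y) \<partial>lborel) = (\<integral>\<^sup>+y\<in>ball z t. ennreal (w y) \<partial>lborel)"
        proof (rule nn_integral_cong)
          fix y
          have "y \<in> ball x (2 * r)" if "y \<in> ball z t"
            using that z False dist_triangle[of x y z] by auto
          then show "ennreal (u y) * indicator (ball z t) y = ennreal (w y) * indicator (ball z t) y"
            by (auto simp: w_def indicator_def)
        qed
        then show ?thesis
          using t unfolding maximal_fun_def by (intro max.coboundedI1 SUP_upper2[of t]) auto
      qed
    qed
    have "(\<integral>\<^sup>+z\<in>ball x r. ennpow p (hl_max u z) \<partial>lborel) \<le>
      (\<integral>\<^sup>+z. ennpow p (hl_max w z) + ennreal (D powr p) * indicator (ball x r) z \<partial>lborel)"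
    proof (rule nn_integral_mono)
      fix z
      have "ennpow p (hl_max u z) \<le> ennpow p (hl_max w z) + ennreal (D powr p)" if "z \<in> ball x r"
      proof -
        have "ennpow p (hl_max u z) \<le> ennpow p (max (hl_max w z) (ennreal D))"
          using p le[OF that] by (intro ennpow_mono) auto
        also have "\<dots> \<le> ennpow p (hl_max w z) + ennpow p (ennreal D)" by (rule ennpow_max)
        finally show ?thesis using D by (simp add: ennpow_ennreal)
      qed
      then show "ennpow p (hl_max u z) * indicator (ball x r) z \<le>
          ennpow p (hl_max w z) + ennreal (D powr p) * indicator (ball x r) z"
        by (auto simp: indicator_def)
    qed
    also have "\<dots> = (\<integral>\<^sup>+z. ennpow p (hl_max w z) \<partial>lborel) + ennreal (D powr p) * emeasure lborel (ball x r)"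
      by (subst nn_integral_add) (auto simp: nn_integral_cmult_indicator)
    also have "(\<integral>\<^sup>+z. ennpow p (hl_max w z) \<partial>lborel) \<le> ennreal C0 * (\<integral>\<^sup>+y. ennreal (w y powr p) \<partial>lborel)"
      using u0 by (intro C0(2) w) (auto simp: w_def)
    also have "(\<integral>\<^sup>+y. ennreal (w y powr p) \<partial>lborel) = (\<integral>\<^sup>+y\<in>ball x (2 * r). ennreal (u y powr p) \<partial>lborel)"
      by (intro nn_integral_cong) (auto simp: w_def indicator_def)
    also have "\<dots> \<le> ennreal (B * (2 * r) powr l)"
      using r by (intro M) auto
    also have "ennreal (D powr p) * emeasure lborel (ball x r) = ennreal ((V + 1) powr p * V * B * r powr l)"
    proof -
      have "D powr p * (V * r powr n) = (V + 1) powr p * V * B * (r powr (l - n) * r powr n)"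
        using V B r p by (simp add: D_def powr_mult powr_powr)
      also have "r powr (l - n) * r powr n = r powr l"
        by (simp flip: powr_add)
      finally show ?thesis
        using r D V by (simp add: emeasure_ball_powr V_def[symmetric] n_def[symmetric] mult_ac flip: ennreal_mult)
    qed
    also have "ennreal C0 * ennreal (B * (2 * r) powr l) + ennreal ((V + 1) powr p * V * B * r powr l) =
        ennreal (C * B * r powr l)"
      using C0 B V r by (simp add: C_def powr_mult algebra_simps ennreal_mult[symmetric]
        ennreal_plus[symmetric] del: ennreal_plus)
    \<comment> \<open>The inequalities in this chain replaced subterms of a sum; what remains to
      prove is the monotonicity of the surrounding expression.\<close>
    finally show ?thesis
      by (auto simp: mult_left_mono add_right_mono)
  qed
  with C show ?thesis by (rule that)
qed

subsection \<open>Hedberg's inequality\<close>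

text \<open>At \<open>y = x\<close> the kernel takes the value 0, as \<open>0 powr _ = 0\<close>,
  instead of being infinite; this concerns one point only.\<close>

definition riesz_ext :: "real \<Rightarrow> ('a::euclidean_space \<Rightarrow> real) \<Rightarrow> 'a \<Rightarrow> ennreal" where
  "riesz_ext a u x = (\<integral>\<^sup>+y. ennreal (u y * norm (x - y) powr (a - real DIM('a))) \<partial>lborel)"

text \<open>The kernel at distance \<open>d\<close> is the integral of
  \<open>(n - a) * s powr (a - n - 1)\<close> over \<open>s > d\<close>, and \<open>d < s\<close>
  says that \<open>y\<close> lies in the ball of radius \<open>s\<close>. Tonelli then expresses the
  potential through masses of balls, a continuous form of the usual dyadic annuli.\<close>

lemma riesz_ext_le_layers:
  fixes u :: "'a::euclidean_space \<Rightarrow> real"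
  assumes u [measurable]: "u \<in> borel_measurable borel" and u0: "\<And>y. 0 \<le> u y"
    and a: "a < real DIM('a)"
  shows "riesz_ext a u x \<le>
    (\<integral>\<^sup>+s. ennreal ((real DIM('a) - a) * s powr (a - real DIM('a) - 1)) * indicator {0<..} s *
      (\<integral>\<^sup>+y\<in>ball x s. ennreal (u y) \<partial>lborel) \<partial>lborel)"
proof -
  define n where "n = real DIM('a)"
  define k where "k s = ennreal ((n - a) * s powr (a - n - 1)) * indicator {0<..} s" for s :: real
  have k[measurable]: "k \<in> borel_measurable borel" unfolding k_def by measurable
  have "riesz_ext a u x \<le> (\<integral>\<^sup>+y. \<integral>\<^sup>+s. k s * (ennreal (u y) * indicator (ball x s) y) \<partial>lborel \<partial>lborel)"
    unfolding riesz_ext_def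
  proof (rule nn_integral_mono)
    fix y
    show "ennreal (u y * norm (x - y) powr (a - real DIM('a))) \<le>
        (\<integral>\<^sup>+s. k s * (ennreal (u y) * indicator (ball x s) y) \<partial>lborel)"
    proof (cases "x = y")
      case False
      define d where "d = norm (x - y)"
      have d: "d > 0" using False by (simp add: d_def)
      have "ennreal (u y * d powr (a - n)) =
          ennreal (u y) * (\<integral>\<^sup>+s. ennreal ((n - a) * s powr (- (n - a) - 1)) * indicator {d..} s \<partial>lborel)"
        using d a u0[of y] by (subst nn_integral_powr_to_inf) (auto simp: n_def ennreal_mult)
      also have "\<dots> = (\<integral>\<^sup>+s. ennreal (u y) * (ennreal ((n - a) * s powr (- (n - a) - 1)) * indicator {d..} s) \<partial>lborel)"
        by (subst nn_integral_cmult) auto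
      also have "\<dots> \<le> (\<integral>\<^sup>+s. k s * (ennreal (u y) * indicator (ball x s) y) \<partial>lborel)"
      proof (rule nn_integral_mono_AE)
        show "AE s in lborel. ennreal (u y) * (ennreal ((n - a) * s powr (- (n - a) - 1)) * indicator {d..} s)
            \<le> k s * (ennreal (u y) * indicator (ball x s) y)"
          using AE_lborel_singleton[of d]
          by eventually_elim (use d in \<open>auto simp: k_def indicator_def dist_norm d_def[symmetric] mult_ac\<close>)
      qed
      finally show ?thesis by (simp add: d_def n_def)
    qed simp
  qed
  also have "\<dots> = (\<integral>\<^sup>+s. \<integral>\<^sup>+y. k s * (ennreal (u y) * indicator (ball x s) y) \<partial>lborel \<partial>lborel)"
  proof (rule lborel_pair.Fubini')
    \<comment> \<open>Membership in a ball of varying radius is rewritten as an inequality between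
      measurable functions of \<open>(s, y)\<close>, from which joint measurability is
      derived.\<close>
    have "(\<lambda>(s, y). k s * (ennreal (u y) * (if dist x y < s then 1 else 0))) \<in>
        borel_measurable (lborel \<Otimes>\<^sub>M lborel)"
      by measurable
    then show "(\<lambda>(s, y). k s * (ennreal (u y) * indicator (ball x s) y)) \<in>
        borel_measurable (lborel \<Otimes>\<^sub>M lborel)"
      by (simp add: indicator_def)
  qed
  also have "\<dots> = (\<integral>\<^sup>+s. k s * (\<integral>\<^sup>+y\<in>ball x s. ennreal (u y) \<partial>lborel) \<partial>lborel)"
    by (intro nn_integral_cong nn_integral_cmult) measurable
  finally show ?thesis by (simp add: k_def n_def)
qed

text \<open>The mass of a ball of radius \<open>s\<close> has two bounds:
  \<open>m * s powr n\<close> from the maximal function and a multiple of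
  \<open>A * s powr (n - \<beta>)\<close> from the Morrey condition. Against the layer weight they
  leave \<open>s powr (a - 1)\<close>, integrable at 0 as \<open>a > 0\<close>, and
  \<open>s powr (a - \<beta> - 1)\<close>, integrable at infinity as \<open>a < \<beta>\<close>.
  Each is used on its side of a radius \<open>\<delta>\<close>.\<close>

lemma hedberg:
  fixes u :: "'a::euclidean_space \<Rightarrow> real"
  assumes u [measurable]: "u \<in> borel_measurable borel" and u0: "\<And>y. 0 \<le> u y"
    and a: "0 < a" "a < real DIM('a)" and p: "1 < p" and b: "a < (real DIM('a) - l) / p"
    and A: "0 < A" and m: "0 < m"
    and M: "\<And>t. 0 < t \<Longrightarrow> (\<integral>\<^sup>+y\<in>ball x t. ennreal (u y powr p) \<partial>lborel) \<le> ennreal (A powr p * t powr l)"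
    and hl: "hl_max u x \<le> ennreal m"
  defines "\<beta> \<equiv> (real DIM('a) - l) / p"
  shows "riesz_ext a u x \<le> ennreal ((real DIM('a) - a) *
    (1 / a + (unit_ball_vol (real DIM('a)) + 1) / (\<beta> - a)) * m powr (1 - a / \<beta>) * A powr (a / \<beta>))"
proof -
  define n where "n = real DIM('a)"
  define V where "V = unit_ball_vol n"
  have V: "V > 0" by (simp add: V_def n_def)
  have \<beta>: "\<beta> > a" using b by (simp add: \<beta>_def)
  \<comment> \<open>At this radius \<open>m * \<delta> powr \<beta> = A\<close>, so up to constants
    the near and far parts have the same size
    \<open>m powr (1 - a / \<beta>) * A powr (a / \<beta>)\<close>.\<close>
  define \<delta> where "\<delta> = (A / m) powr (1 / \<beta>)"
  have \<delta>: "\<delta> > 0" using A m by (simp add: \<delta>_def)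
  have na: "n - a > 0" using a by (simp add: n_def)
  define N where "N s = (\<integral>\<^sup>+y\<in>ball x s. ennreal (u y) \<partial>lborel)" for s
  have N1: "N s \<le> ennreal (m * s powr n)" if "s > 0" for s
  proof -
    have "N s \<le> hl_max u x * ennreal (s powr n)"
      unfolding N_def n_def using that by (intro maximal_fun_upper) auto
    also have "\<dots> \<le> ennreal m * ennreal (s powr n)"
      using hl by (intro mult_right_mono) auto
    finally show ?thesis using m by (simp add: ennreal_mult)
  qed
  have N2: "N s \<le> ennreal ((V + 1) * A * s powr (n - \<beta>))" if "s > 0" for s
  proof -
    have "N s \<le> ennreal ((V + 1) * (A powr p) powr (1 / p) * s powr (n + (l - n) / p))"
      unfolding N_def V_def n_def using A that
      by (intro nn_integral_ball_le_of_morrey u u0 p M) auto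
    moreover have "n + (l - n) / p = n - \<beta>"
      using p by (simp add: \<beta>_def n_def field_simps)
    ultimately show ?thesis using A p by (simp add: powr_powr)
  qed
  define c1 where "c1 = (n - a) * m / a"
  define c2 where "c2 = (n - a) * (V + 1) * A / (\<beta> - a)"
  have c: "c1 \<ge> 0" "c2 \<ge> 0" using na m A V a \<beta> by (auto simp: c1_def c2_def)
  have "riesz_ext a u x \<le> (\<integral>\<^sup>+s. ennreal ((n - a) * s powr (a - n - 1)) * indicator {0<..} s * N s \<partial>lborel)"
    unfolding N_def n_def by (intro riesz_ext_le_layers u u0 a)
  also have "\<dots> \<le> (\<integral>\<^sup>+s. ennreal c1 * (ennreal (a * s powr (a - 1)) * indicator {0..\<delta>} s) +
      ennreal c2 * (ennreal ((\<beta> - a) * s powr (- (\<beta> - a) - 1)) * indicator {\<delta>..} s) \<partial>lborel)"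
  proof (rule nn_integral_mono)
    fix s :: real
    have near: "ennreal ((n - a) * s powr (a - n - 1)) * N s \<le> ennreal c1 * ennreal (a * s powr (a - 1))"
      if "s > 0"
    proof -
      have "ennreal ((n - a) * s powr (a - n - 1)) * N s \<le>
          ennreal ((n - a) * s powr (a - n - 1)) * ennreal (m * s powr n)"
        using that by (intro mult_left_mono N1) auto
      also have "\<dots> = ennreal ((n - a) * m * (s powr (a - n - 1) * s powr n))"
        using na m by (simp add: ennreal_mult[symmetric] mult_ac)
      also have "s powr (a - n - 1) * s powr n = s powr (a - 1)"
        by (simp flip: powr_add)
      finally show ?thesis
        using c a by (simp add: ennreal_mult[symmetric] c1_def mult.assoc)
    qed
    have far: "ennreal ((n - a) * s powr (a - n - 1)) * N s \<le>
        ennreal c2 * ennreal ((\<beta> - a) * s powr (- (\<beta> - a) - 1))" if "s > 0"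
    proof -
      have "ennreal ((n - a) * s powr (a - n - 1)) * N s \<le>
          ennreal ((n - a) * s powr (a - n - 1)) * ennreal ((V + 1) * A * s powr (n - \<beta>))"
        using that by (intro mult_left_mono N2) auto
      also have "\<dots> = ennreal ((n - a) * (V + 1) * A * (s powr (a - n - 1) * s powr (n - \<beta>)))"
        using na A V by (simp add: ennreal_mult[symmetric] mult_ac)
      also have "s powr (a - n - 1) * s powr (n - \<beta>) = s powr (- (\<beta> - a) - 1)"
        by (simp add: algebra_simps flip: powr_add)
      finally show ?thesis
        using c \<beta> by (simp add: ennreal_mult[symmetric] c2_def mult.assoc)
    qed
    show "ennreal ((n - a) * s powr (a - n - 1)) * indicator {0<..} s * N s \<le>
      ennreal c1 * (ennreal (a * s powr (a - 1)) * indicator {0..\<delta>} s) +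
      ennreal c2 * (ennreal ((\<beta> - a) * s powr (- (\<beta> - a) - 1)) * indicator {\<delta>..} s)"
    proof (cases "0 < s")
      case True
      show ?thesis
      proof (cases "s \<le> \<delta>")
        case True
        then show ?thesis using near \<open>0 < s\<close> by (auto simp: add_increasing2)
      next
        case False
        then show ?thesis using far \<open>0 < s\<close> by (auto simp: add_increasing)
      qed
    qed simp
  qed
  also have "\<dots> = ennreal c1 * (\<integral>\<^sup>+s. ennreal (a * s powr (a - 1)) * indicator {0..\<delta>} s \<partial>lborel) +
      ennreal c2 * (\<integral>\<^sup>+s. ennreal ((\<beta> - a) * s powr (- (\<beta> - a) - 1)) * indicator {\<delta>..} s \<partial>lborel)"
    by (subst nn_integral_add) (auto simp: nn_integral_cmult)
  also have "\<dots> = ennreal c1 * ennreal (\<delta> powr a) + ennreal c2 * ennreal (\<delta> powr - (\<beta> - a))"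
    using a \<beta> \<delta> by (subst nn_integral_powr_from_0, simp_all, subst nn_integral_powr_to_inf[of "\<beta> - a", simplified], simp_all)
  also have "\<dots> = ennreal (c1 * \<delta> powr a + c2 * \<delta> powr - (\<beta> - a))"
    using c by (simp add: ennreal_mult[symmetric] ennreal_plus[symmetric] del: ennreal_plus)
  also have "c1 * \<delta> powr a + c2 * \<delta> powr - (\<beta> - a) =
      (n - a) * (1 / a + (V + 1) / (\<beta> - a)) * m powr (1 - a / \<beta>) * A powr (a / \<beta>)"
  proof -
    have 1: "m * \<delta> powr a = m powr (1 - a / \<beta>) * A powr (a / \<beta>)"
      using A m by (simp add: \<delta>_def powr_powr powr_divide powr_diff)
    have "\<delta> powr - (\<beta> - a) = (A / m) powr (a / \<beta> - 1)"
      using \<beta> a by (simp add: \<delta>_def powr_powr diff_divide_distrib)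
    then have 2: "A * \<delta> powr - (\<beta> - a) = m powr (1 - a / \<beta>) * A powr (a / \<beta>)"
      using A m by (simp add: powr_divide powr_diff field_simps)
    have "c1 * \<delta> powr a + c2 * \<delta> powr - (\<beta> - a) =
        (n - a) / a * (m * \<delta> powr a) + (n - a) * (V + 1) / (\<beta> - a) * (A * \<delta> powr - (\<beta> - a))"
      by (simp add: c1_def c2_def)
    also have "\<dots> = (n - a) * (1 / a + (V + 1) / (\<beta> - a)) * (m powr (1 - a / \<beta>) * A powr (a / \<beta>))"
      unfolding 1 2 by (simp add: algebra_simps)
    finally show ?thesis by simp
  qed
  finally show ?thesis by (simp add: V_def n_def)
qed

lemma borel_measurable_riesz_ext [measurable]:
  assumes [measurable]: "u \<in> borel_measurable borel"
  shows "riesz_ext a u \<in> borel_measurable borel"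
proof -
  have "(\<lambda>x. \<integral>\<^sup>+y. ennreal (u y * norm (x - y) powr (a - real DIM('a))) \<partial>lborel) \<in> borel_measurable borel"
    by (rule lborel.borel_measurable_nn_integral) measurable
  then show ?thesis unfolding riesz_ext_def[abs_def] .
qed

lemma riesz_ext_cong_AE:
  assumes "AE y in lborel. u y = v y"
  shows "riesz_ext a u = riesz_ext a v"
proof
  fix x
  show "riesz_ext a u x = riesz_ext a v x"
    unfolding riesz_ext_def using assms by (intro nn_integral_cong_AE) (auto elim: eventually_mono)
qed

text \<open>Hedberg's exponents are \<open>1 - a / \<beta> = p / q\<close> and
  \<open>a / \<beta> = (q - p) / q\<close>; raising to the power \<open>q\<close> clears the
  denominators.\<close>

lemma ennpow_riesz_ext_le:
  assumes a: "0 < a" "a < real DIM('a)" and p: "1 < p" and b: "a < (real DIM('a) - l) / p"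
    and l: "l < real DIM('a)"
    and q: "1 / q = 1 / p - a / (real DIM('a) - l)"
  obtains C where "0 < C"
    "\<And>(u :: 'a::euclidean_space \<Rightarrow> real) x A.
      u \<in> borel_measurable borel \<Longrightarrow> (\<And>y. 0 \<le> u y) \<Longrightarrow> 0 < A \<Longrightarrow>
      (\<And>t. 0 < t \<Longrightarrow> (\<integral>\<^sup>+y\<in>ball x t. ennreal (u y powr p) \<partial>lborel) \<le> ennreal (A powr p * t powr l)) \<Longrightarrow>
      ennpow q (riesz_ext a u x) \<le> ennreal (C * A powr (q - p)) * ennpow p (hl_max u x)"
proof -
  define n where "n = real DIM('a)"
  define V where "V = unit_ball_vol n"
  have V: "V > 0" by (simp add: V_def n_def)
  define \<beta> where "\<beta> = (n - l) / p"
  have \<beta>: "\<beta> > a" using b by (simp add: \<beta>_def n_def)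
  have nl: "n - l > 0" using l by (simp add: n_def)
  have a\<beta>: "a / \<beta> = p * (a / (n - l))" using nl p by (simp add: \<beta>_def)
  have "1 / q = (1 - a / \<beta>) / p"
    using q p unfolding a\<beta> n_def[symmetric] by (simp add: diff_divide_distrib)
  moreover have "(1 - a / \<beta>) / p > 0" using \<beta> a p by simp
  ultimately have q0: "q > 0" by (metis zero_less_divide_1_iff)
  have e: "1 - a / \<beta> = p / q"
    using \<open>1 / q = (1 - a / \<beta>) / p\<close> p q0 by (simp add: field_simps)
  have e': "a / \<beta> = (q - p) / q"
    using e q0 by (simp add: field_simps)
  define K where "K = (n - a) * (1 / a + (V + 1) / (\<beta> - a))"
  have K: "K > 0" using a \<beta> V unfolding K_def n_def by (intro mult_pos_pos add_pos_pos divide_pos_pos) auto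
  have "ennpow q (riesz_ext a u x) \<le> ennreal (K powr q * A powr (q - p)) * ennpow p (hl_max u x)"
    if u: "u \<in> borel_measurable borel" "\<And>y. 0 \<le> u y" and A: "0 < A"
      and M: "\<And>t. 0 < t \<Longrightarrow> (\<integral>\<^sup>+y\<in>ball x t. ennreal (u y powr p) \<partial>lborel) \<le> ennreal (A powr p * t powr l)"
    for u :: "'a \<Rightarrow> real" and x A
  proof (cases "hl_max u x")
    case (real m)
    show ?thesis
    proof (cases "m = 0")
      \<comment> \<open>Hedberg's splitting radius requires \<open>m > 0\<close>. If the maximal
        function vanishes at \<open>x\<close>, every ball about \<open>x\<close> has mass 0, and so
        the layer formula gives potential 0.\<close>
      case True
      have "(\<integral>\<^sup>+y\<in>ball x s. ennreal (u y) \<partial>lborel) = 0" if "s > 0" for s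
        using maximal_fun_upper[of s "\<lambda>t. t powr real DIM('a)" u x] that real True by simp
      then have "(\<lambda>s. ennreal ((real DIM('a) - a) * s powr (a - real DIM('a) - 1)) * indicator {0<..} s *
        (\<integral>\<^sup>+y\<in>ball x s. ennreal (u y) \<partial>lborel)) = (\<lambda>s. 0)"
        by (auto simp: indicator_def)
      then have "riesz_ext a u x = 0"
        using riesz_ext_le_layers[OF u a(2), of x] by simp
      then show ?thesis by simp
    next
      case False
      then have m: "m > 0" using real by simp
      have "riesz_ext a u x \<le> ennreal (K * m powr (1 - a / \<beta>) * A powr (a / \<beta>))"
        unfolding K_def V_def n_def \<beta>_def using real
        by (intro hedberg u a p b A m M) auto
      then have "ennpow q (riesz_ext a u x) \<le> ennpow q (ennreal (K * m powr (p / q) * A powr ((q - p) / q)))"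
        using q0 unfolding e unfolding e' by (intro ennpow_mono) auto
      also have "\<dots> = ennreal ((K * m powr (p / q) * A powr ((q - p) / q)) powr q)"
        using K by (intro ennpow_ennreal) auto
      also have "(K * m powr (p / q) * A powr ((q - p) / q)) powr q = K powr q * A powr (q - p) * m powr p"
        using K m A q0 by (simp add: powr_mult powr_powr)
      finally show ?thesis
        using real m by (simp add: ennpow_ennreal ennreal_mult)
    qed
  next
    case top
    then show ?thesis using K A by (simp add: ennreal_mult_top)
  qed
  with K show ?thesis by (intro that[of "K powr q"]) auto
qed

text \<open>The two Morrey constants have different tasks: \<open>A\<close> serves the pointwise
  inequality and covers all radii, \<open>B\<close> serves the maximal function and covers radii
  from \<open>r\<close> on. The choice \<open>B = A powr p\<close> will give boundedness; fixed
  \<open>A\<close> and small \<open>B\<close> will give vanishing.\<close>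

lemma riesz_ext_morrey_bound:
  assumes a: "0 < a" "a < real DIM('a)" and p: "1 < p" and b: "a < (real DIM('a) - l) / p"
    and l: "0 \<le> l" "l < real DIM('a)"
    and q: "1 / q = 1 / p - a / (real DIM('a) - l)"
  obtains C where "0 < C"
    "\<And>(u :: 'a::euclidean_space \<Rightarrow> real) x r A B.
      u \<in> borel_measurable borel \<Longrightarrow> (\<And>y. 0 \<le> u y) \<Longrightarrow> 0 < r \<Longrightarrow> 0 < A \<Longrightarrow> 0 < B \<Longrightarrow>
      (\<And>z t. 0 < t \<Longrightarrow> (\<integral>\<^sup>+y\<in>ball z t. ennreal (u y powr p) \<partial>lborel) \<le> ennreal (A powr p * t powr l)) \<Longrightarrow>
      (\<And>z t. r \<le> t \<Longrightarrow> (\<integral>\<^sup>+y\<in>ball z t. ennreal (u y powr p) \<partial>lborel) \<le> ennreal (B * t powr l)) \<Longrightarrow>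
      (\<integral>\<^sup>+z\<in>ball x r. ennpow q (riesz_ext a u z) \<partial>lborel) \<le> ennreal (C * A powr (q - p) * B * r powr l)"
proof -
  obtain C1 where C1: "0 < C1"
    "\<And>(u :: 'a \<Rightarrow> real) x A. u \<in> borel_measurable borel \<Longrightarrow> (\<And>y. 0 \<le> u y) \<Longrightarrow> 0 < A \<Longrightarrow>
      (\<And>t. 0 < t \<Longrightarrow> (\<integral>\<^sup>+y\<in>ball x t. ennreal (u y powr p) \<partial>lborel) \<le> ennreal (A powr p * t powr l)) \<Longrightarrow>
      ennpow q (riesz_ext a u x) \<le> ennreal (C1 * A powr (q - p)) * ennpow p (hl_max u x)"
    using ennpow_riesz_ext_le[OF a p b l(2) q] by blast
  obtain C2 where C2: "0 < C2"
    "\<And>(u :: 'a \<Rightarrow> real) x r B. u \<in> borel_measurable borel \<Longrightarrow> (\<And>y. 0 \<le> u y) \<Longrightarrow> 0 < r \<Longrightarrow> 0 < B \<Longrightarrow>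
      (\<And>z t. r \<le> t \<Longrightarrow> (\<integral>\<^sup>+y\<in>ball z t. ennreal (u y powr p) \<partial>lborel) \<le> ennreal (B * t powr l)) \<Longrightarrow>
      (\<integral>\<^sup>+z\<in>ball x r. ennpow p (hl_max u z) \<partial>lborel) \<le> ennreal (C2 * B * r powr l)"
    using hl_max_morrey_bound[OF p l(1) less_imp_le[OF l(2)]] by blast
  show ?thesis
  proof (rule that[of "C1 * C2"])
    fix u :: "'a \<Rightarrow> real" and x r A B
    assume u[measurable]: "u \<in> borel_measurable borel" and u0: "\<And>y. 0 \<le> u y"
      and r: "0 < r" and A: "0 < A" and B: "0 < B"
      and MA: "\<And>z t. 0 < t \<Longrightarrow> (\<integral>\<^sup>+y\<in>ball z t. ennreal (u y powr p) \<partial>lborel) \<le> ennreal (A powr p * t powr l)"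
      and MB: "\<And>z t. r \<le> t \<Longrightarrow> (\<integral>\<^sup>+y\<in>ball z t. ennreal (u y powr p) \<partial>lborel) \<le> ennreal (B * t powr l)"
    have "(\<integral>\<^sup>+z\<in>ball x r. ennpow q (riesz_ext a u z) \<partial>lborel) \<le>
      (\<integral>\<^sup>+z. ennreal (C1 * A powr (q - p)) * (ennpow p (hl_max u z) * indicator (ball x r) z) \<partial>lborel)"
      using C1(2)[OF u u0 A MA] by (intro nn_integral_mono) (auto simp: indicator_def)
    also have "\<dots> = ennreal (C1 * A powr (q - p)) * (\<integral>\<^sup>+z\<in>ball x r. ennpow p (hl_max u z) \<partial>lborel)"
      by (rule nn_integral_cmult) measurable
    also have "\<dots> \<le> ennreal (C1 * A powr (q - p)) * ennreal (C2 * B * r powr l)"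
      by (intro mult_left_mono C2(2) u u0 r B MB) auto
    also have "\<dots> = ennreal (C1 * C2 * A powr (q - p) * B * r powr l)"
      using C1(1) C2(1) B by (simp add: mult_ac flip: ennreal_mult)
    finally show "(\<integral>\<^sup>+z\<in>ball x r. ennpow q (riesz_ext a u z) \<partial>lborel) \<le> \<dots>" .
  qed (use C1 C2 in auto)
qed

subsection \<open>Morrey spaces\<close>

text \<open>Links the real-valued modular over \<open>lebesgue\<close> to the extended integrals
  over \<open>lborel\<close>. Integrability on the compact closed ball guarantees that the Bochner
  integral is not a default value.\<close>

lemma nn_integral_ball_eq_morrey_modular:
  assumes f: "locally_p_integrable p f" and r: "0 < r"
  shows "(\<integral>\<^sup>+y\<in>ball x r. ennreal (norm (f y) powr p) \<partial>lborel) =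
    ennreal (morrey_modular p l f x r * r powr l)"
proof -
  have "set_integrable lebesgue (cball x r) (\<lambda>y. norm (f y) powr p)"
    using f by (simp add: locally_p_integrable_def)
  then have "set_integrable lebesgue (ball x r) (\<lambda>y. norm (f y) powr p)"
    by (rule set_integrable_subset) auto
  then have "(\<integral>\<^sup>+y. ennreal (indicator (ball x r) y *\<^sub>R norm (f y) powr p) \<partial>lebesgue) =
    ennreal (LINT y:ball x r|lebesgue. norm (f y) powr p)"
    unfolding set_integrable_def set_lebesgue_integral_def
    by (intro nn_integral_eq_integral) auto
  moreover have "(\<integral>\<^sup>+y. ennreal (indicator (ball x r) y *\<^sub>R norm (f y) powr p) \<partial>lebesgue) =
    (\<integral>\<^sup>+y\<in>ball x r. ennreal (norm (f y) powr p) \<partial>lborel)"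
    unfolding nn_integral_completion by (intro nn_integral_cong) (auto simp: indicator_def)
  ultimately show ?thesis
    using r by (simp add: morrey_modular_def)
qed

lemma morrey_modular_nonneg: "0 \<le> morrey_modular p l f x r"
  unfolding morrey_modular_def set_lebesgue_integral_def
  by (intro mult_nonneg_nonneg integral_nonneg_AE) auto

lemma morrey_modular_le:
  assumes f: "locally_p_integrable p f" and r: "0 < r" and c: "0 \<le> c"
    and le: "(\<integral>\<^sup>+y\<in>ball x r. ennreal (norm (f y) powr p) \<partial>lborel) \<le> ennreal (c * r powr l)"
  shows "morrey_modular p l f x r \<le> c"
  using le r c by (simp add: nn_integral_ball_eq_morrey_modular[OF f r, of _ l])

lemma morrey_modular_powr_le_norm:
  assumes "f \<in> morrey_space p l" "0 < r"
  shows "morrey_modular p l f x r powr (1 / p) \<le> morrey_norm p l f"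
proof -
  have "(\<lambda>(x, r). morrey_modular p l f x r powr (1 / p)) (x, r) \<le> morrey_norm p l f"
    unfolding morrey_norm_def using assms by (intro cSUP_upper) (auto simp: morrey_space_def)
  then show ?thesis by simp
qed

lemma morrey_norm_nonneg:
  assumes "f \<in> morrey_space p l"
  shows "0 \<le> morrey_norm p l f"
  by (rule order_trans[OF powr_ge_zero morrey_modular_powr_le_norm[OF assms zero_less_one]])

lemma morrey_modular_le_norm:
  assumes f: "f \<in> morrey_space p l" and p: "0 < p" and r: "0 < r" and A: "morrey_norm p l f \<le> A"
  shows "morrey_modular p l f x r \<le> A powr p"
proof -
  have "(morrey_modular p l f x r powr (1 / p)) powr p \<le> A powr p"
    using morrey_modular_powr_le_norm[OF f r, of x] A p by (intro powr_mono2) auto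
  then show ?thesis using p morrey_modular_nonneg[of p l f x r] by (simp add: powr_powr)
qed

lemma vanishing_morrey_space_tail:
  assumes f: "f \<in> vanishing_morrey_space p l" and p: "0 < p" and B: "0 < B"
  obtains R where "0 < R" "\<And>x r. R \<le> r \<Longrightarrow> morrey_modular p l f x r \<le> B"
proof -
  have fm: "f \<in> morrey_space p l" using f by (simp add: vanishing_morrey_space_def)
  have "((\<lambda>r. SUP x. morrey_modular p l f x r) \<longlongrightarrow> 0) at_top"
    using f by (simp add: vanishing_morrey_space_def)
  then have "eventually (\<lambda>r. (SUP x. morrey_modular p l f x r) < B) at_top"
    using B by (rule order_tendstoD)
  then obtain R where R: "\<And>r. R \<le> r \<Longrightarrow> (SUP x. morrey_modular p l f x r) < B"
    by (auto simp: eventually_at_top_linorder)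
  \<comment> \<open>The real supremum bounds its members only if the family is bounded, and the
    Morrey norm provides this at positive radii; hence the threshold is raised to at least
    1.\<close>
  show ?thesis
  proof (rule that[of "max R 1"])
    fix x r assume r: "max R 1 \<le> r"
    have "bdd_above (range (\<lambda>x. morrey_modular p l f x r))"
      using r by (intro bdd_aboveI2[where M = "morrey_norm p l f powr p"] morrey_modular_le_norm fm p) auto
    then have "morrey_modular p l f x r \<le> (SUP x. morrey_modular p l f x r)"
      by (rule cSUP_upper[rotated]) simp
    also have "\<dots> < B" using r by (intro R) simp
    finally show "morrey_modular p l f x r \<le> B" by simp
  qed simp
qed

lemma locally_p_integrableI:
  fixes g :: "real ^ 'n \<Rightarrow> 'a::euclidean_space"
  assumes g [measurable]: "g \<in> borel_measurable lebesgue"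
    and fin: "\<And>r. 0 < r \<Longrightarrow> (\<integral>\<^sup>+y\<in>ball 0 r. ennreal (norm (g y) powr p) \<partial>lborel) < \<infinity>"
  shows "locally_p_integrable p g"
  unfolding locally_p_integrable_def
proof (intro conjI allI impI)
  fix K :: "(real ^ 'n) set" assume K: "compact K"
  obtain r where r: "0 < r" "K \<subseteq> ball 0 r"
    using bounded_subset_ballD[OF compact_imp_bounded[OF K], of 0] by auto
  have K'[measurable]: "K \<in> sets lebesgue" using K by (simp add: compact_imp_closed)
  show "set_integrable lebesgue K (\<lambda>y. norm (g y) powr p)"
    unfolding set_integrable_def
  proof (rule integrableI_bounded)
    show "(\<lambda>y. indicator K y *\<^sub>R norm (g y) powr p) \<in> borel_measurable lebesgue" by measurable
    have "(\<integral>\<^sup>+y. ennreal (norm (indicator K y *\<^sub>R norm (g y) powr p)) \<partial>lebesgue) \<le>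
      (\<integral>\<^sup>+y\<in>ball 0 r. ennreal (norm (g y) powr p) \<partial>lborel)"
      unfolding nn_integral_completion using r by (intro nn_integral_mono) (auto simp: indicator_def)
    also have "\<dots> < \<infinity>" by (rule fin) fact
    finally show "(\<integral>\<^sup>+y. ennreal (norm (indicator K y *\<^sub>R norm (g y) powr p)) \<partial>lebesgue) < \<infinity>" .
  qed
qed (rule g)

lemma morrey_spaceI:
  assumes g: "g \<in> borel_measurable lebesgue" and q: "0 < q" and M: "0 \<le> M"
    and le: "\<And>x r. 0 < r \<Longrightarrow>
      (\<integral>\<^sup>+y\<in>ball x r. ennreal (norm (g y) powr q) \<partial>lborel) \<le> ennreal (M powr q * r powr l)"
  shows "g \<in> morrey_space q l" and "morrey_norm q l g \<le> M"
proof -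
  have loc: "locally_p_integrable q g"
    by (intro locally_p_integrableI g le_less_trans[OF le]) auto
  have bound: "morrey_modular q l g x r powr (1 / q) \<le> M" if "0 < r" for x r
  proof -
    have "morrey_modular q l g x r powr (1 / q) \<le> (M powr q) powr (1 / q)"
      using that q by (intro powr_mono2 morrey_modular_le loc le morrey_modular_nonneg) auto
    then show ?thesis using q M by (simp add: powr_powr)
  qed
  then show "g \<in> morrey_space q l"
    using loc by (auto simp: morrey_space_def intro!: bdd_aboveI2[where M = M])
  show "morrey_norm q l g \<le> M"
    unfolding morrey_norm_def using bound by (intro cSUP_least) auto
qed

lemma vanishing_morrey_spaceI:
  assumes g: "g \<in> morrey_space q l"
    and ev: "\<And>e. 0 < e \<Longrightarrow> \<exists>R. \<forall>r\<ge>R. \<forall>x. morrey_modular q l g x r \<le> e"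
  shows "g \<in> vanishing_morrey_space q l"
proof -
  have "((\<lambda>r. SUP x. morrey_modular q l g x r) \<longlongrightarrow> 0) at_top"
  proof (rule tendstoI)
    fix e :: real assume e: "0 < e"
    obtain R where R: "\<And>r x. R \<le> r \<Longrightarrow> morrey_modular q l g x r \<le> e / 2"
      using ev[of "e / 2"] e by auto
    have "dist (SUP x. morrey_modular q l g x r) 0 < e" if "R \<le> r" for r
    proof -
      have "(SUP x. morrey_modular q l g x r) \<le> e / 2"
        by (intro cSUP_least R that) auto
      moreover have "morrey_modular q l g 0 r \<le> (SUP x. morrey_modular q l g x r)"
        by (intro cSUP_upper bdd_aboveI2[where M = "e / 2"] R that) auto
      then have "0 \<le> (SUP x. morrey_modular q l g x r)"
        using morrey_modular_nonneg order_trans by blast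
      ultimately show ?thesis using e by simp
    qed
    then show "eventually (\<lambda>r. dist (SUP x. morrey_modular q l g x r) 0 < e) at_top"
      unfolding eventually_at_top_linorder by blast
  qed
  with g show ?thesis by (simp add: vanishing_morrey_space_def)
qed

text \<open>Gives access to the estimates for Borel functions. The representative is cut off at 0 so
  that it is nonnegative everywhere, not just almost everywhere.\<close>

lemma vanishing_morrey_space_borel:
  fixes f :: "real ^ 'n \<Rightarrow> 'a::euclidean_space"
  assumes f: "f \<in> vanishing_morrey_space p l"
  obtains u where "u \<in> borel_measurable borel" "\<And>y. 0 \<le> u y" "AE y in lborel. u y = norm (f y)"
proof -
  have [measurable]: "f \<in> borel_measurable lebesgue"
    using f by (simp add: vanishing_morrey_space_def morrey_space_def locally_p_integrable_def)
  have "(\<lambda>y. norm (f y)) \<in> borel_measurable (completion lborel)" by measurable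
  from completion_ex_borel_measurable_real[OF this]
  obtain v where v: "v \<in> borel_measurable lborel" "AE y in lborel. norm (f y) = v y" by blast
  show ?thesis
  proof (rule that[of "\<lambda>y. max 0 (v y)"])
    show "(\<lambda>y. max 0 (v y)) \<in> borel_measurable borel" using v(1) by simp
    show "AE y in lborel. max 0 (v y) = norm (f y)"
      using v(2) by eventually_elim (metis max.absorb2 norm_ge_zero)
  qed simp
qed

text \<open>Reduces each operator to measurability and a pointwise comparison with the potential of
  the norm. The origin is exempt from the condition on \<open>D\<close> because the dual Hardy
  kernel, singular at \<open>y = 0\<close>, is dominated by the Riesz kernel only for
  \<open>x \<noteq> 0\<close>.\<close>

lemma bounded_on_vanishing_morrey_of_riesz_bound:
  fixes T :: "(real ^ 'n \<Rightarrow> 'a::euclidean_space) \<Rightarrow> real ^ 'n \<Rightarrow> 'b::euclidean_space"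
  assumes a: "0 < a" "a < real CARD('n)" and p: "1 < p" and b: "a < (real CARD('n) - l) / p"
    and l: "0 \<le> l" "l < real CARD('n)"
    and q: "1 / q = 1 / p - a / (real CARD('n) - l)"
    and T: "\<And>f. f \<in> borel_measurable lebesgue \<Longrightarrow> T f \<in> borel_measurable lebesgue"
    and D: "\<And>f x. f \<in> borel_measurable lebesgue \<Longrightarrow> x \<noteq> 0 \<Longrightarrow>
      riesz_ext a (\<lambda>y. norm (f y)) x < \<infinity> \<Longrightarrow> D f x"
    and K: "0 < K"
    and TK: "\<And>f x. f \<in> borel_measurable lebesgue \<Longrightarrow>
      ennreal (norm (T f x)) \<le> ennreal K * riesz_ext a (\<lambda>y. norm (f y)) x"
  shows "bounded_on_vanishing_morrey p q l D T"
proof -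
  have nl: "real CARD('n) - l > 0" using l by simp
  have "a * p < real CARD('n) - l" using b p by (simp add: field_simps)
  then have "a / (real CARD('n) - l) < 1 / p"
    using p nl by (simp add: field_simps)
  then have "1 / q > 0" using q by simp
  then have q0: "q > 0" by simp
  obtain C where C: "0 < C"
    "\<And>(u :: real ^ 'n \<Rightarrow> real) x r A B.
      u \<in> borel_measurable borel \<Longrightarrow> (\<And>y. 0 \<le> u y) \<Longrightarrow> 0 < r \<Longrightarrow> 0 < A \<Longrightarrow> 0 < B \<Longrightarrow>
      (\<And>z t. 0 < t \<Longrightarrow> (\<integral>\<^sup>+y\<in>ball z t. ennreal (u y powr p) \<partial>lborel) \<le> ennreal (A powr p * t powr l)) \<Longrightarrow>
      (\<And>z t. r \<le> t \<Longrightarrow> (\<integral>\<^sup>+y\<in>ball z t. ennreal (u y powr p) \<partial>lborel) \<le> ennreal (B * t powr l)) \<Longrightarrow>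
      (\<integral>\<^sup>+z\<in>ball x r. ennpow q (riesz_ext a u z) \<partial>lborel) \<le> ennreal (C * A powr (q - p) * B * r powr l)"
    using riesz_ext_morrey_bound[where 'a = "real ^ 'n", unfolded DIM_cart DIM_real mult_1_right,
      OF a p b l q] by blast
  \<comment> \<open>Chosen so that
    \<open>(C' * A) powr q = K powr q * C * A powr (q - p) * A powr p\<close>, the modular bound
    with \<open>B = A powr p\<close>.\<close>
  define C' where "C' = K * C powr (1 / q)"
  have C': "C' > 0" using C K by (simp add: C'_def)
  have "(AE x in lebesgue. D f x) \<and> T f \<in> vanishing_morrey_space q l \<and>
      morrey_norm q l (T f) \<le> C' * morrey_norm p l f"
    if f: "f \<in> vanishing_morrey_space p l" for f
  proof -
    have fm: "f \<in> morrey_space p l" using f by (simp add: vanishing_morrey_space_def)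
    then have loc: "locally_p_integrable p f" by (simp add: morrey_space_def)
    then have f_meas: "f \<in> borel_measurable lebesgue" by (simp add: locally_p_integrable_def)
    obtain u where u[measurable]: "u \<in> borel_measurable borel" and u0: "\<And>y. 0 \<le> u y"
      and ae: "AE y in lborel. u y = norm (f y)"
      using vanishing_morrey_space_borel[OF f] by blast
    let ?J = "riesz_ext a u"
    have J: "riesz_ext a (\<lambda>y. norm (f y)) = ?J"
      using ae by (intro riesz_ext_cong_AE) (auto elim: eventually_mono)
    have u_mod: "(\<integral>\<^sup>+y\<in>ball z t. ennreal (u y powr p) \<partial>lborel) = ennreal (morrey_modular p l f z t * t powr l)"
      if "0 < t" for z t
    proof -
      have "(\<integral>\<^sup>+y\<in>ball z t. ennreal (u y powr p) \<partial>lborel) = (\<integral>\<^sup>+y\<in>ball z t. ennreal (norm (f y) powr p) \<partial>lborel)"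
        using ae by (intro nn_integral_cong_AE) (auto elim: eventually_mono)
      then show ?thesis using nn_integral_ball_eq_morrey_modular[OF loc that] by simp
    qed
    have main: "(\<integral>\<^sup>+z\<in>ball x r. ennpow q (?J z) \<partial>lborel) \<le> ennreal (C * A powr (q - p) * B * r powr l)"
      if r: "0 < r" and A: "0 < A" "morrey_norm p l f \<le> A" and B: "0 < B"
        and tail: "\<And>z t. r \<le> t \<Longrightarrow> morrey_modular p l f z t \<le> B" for x r A B
    proof (rule C(2)[OF u u0 r A(1) B])
      show "(\<integral>\<^sup>+y\<in>ball z t. ennreal (u y powr p) \<partial>lborel) \<le> ennreal (A powr p * t powr l)" if "0 < t" for z t
        unfolding u_mod[OF that] using p A(2)
        by (intro ennreal_leI mult_right_mono morrey_modular_le_norm fm that) auto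
      show "(\<integral>\<^sup>+y\<in>ball z t. ennreal (u y powr p) \<partial>lborel) \<le> ennreal (B * t powr l)" if "r \<le> t" for z t
      proof -
        have "0 < t" using that r by simp
        then show ?thesis
          unfolding u_mod[OF \<open>0 < t\<close>] by (intro ennreal_leI mult_right_mono tail that) auto
      qed
    qed
    have Tf_le: "(\<integral>\<^sup>+z\<in>ball x r. ennreal (norm (T f z) powr q) \<partial>lborel) \<le>
        ennreal (K powr q * C * A powr (q - p) * B * r powr l)"
      if r: "0 < r" and A: "0 < A" "morrey_norm p l f \<le> A" and B: "0 < B"
        and tail: "\<And>z t. r \<le> t \<Longrightarrow> morrey_modular p l f z t \<le> B" for x r A B
    proof -
      have "ennreal (norm (T f z) powr q) \<le> ennreal (K powr q) * ennpow q (?J z)" for z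
      proof -
        have "ennpow q (ennreal (norm (T f z))) \<le> ennpow q (ennreal K * ?J z)"
          using TK[OF f_meas, of z] q0 unfolding J by (intro ennpow_mono) auto
        then show ?thesis using K by (simp add: ennpow_cmult ennpow_ennreal)
      qed
      then have "(\<integral>\<^sup>+z\<in>ball x r. ennreal (norm (T f z) powr q) \<partial>lborel) \<le>
          (\<integral>\<^sup>+z. ennreal (K powr q) * (ennpow q (?J z) * indicator (ball x r) z) \<partial>lborel)"
        by (intro nn_integral_mono) (auto simp: indicator_def)
      also have "\<dots> = ennreal (K powr q) * (\<integral>\<^sup>+z\<in>ball x r. ennpow q (?J z) \<partial>lborel)"
        by (rule nn_integral_cmult) measurable
      also have "\<dots> \<le> ennreal (K powr q) * ennreal (C * A powr (q - p) * B * r powr l)"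
        by (intro mult_left_mono main r A B tail) auto
      also have "\<dots> = ennreal (K powr q * C * A powr (q - p) * B * r powr l)"
        using C B by (simp add: mult_ac flip: ennreal_mult)
      finally show ?thesis .
    qed
    have Tf_morrey: "(\<integral>\<^sup>+z\<in>ball x r. ennreal (norm (T f z) powr q) \<partial>lborel) \<le>
        ennreal ((C' * A) powr q * r powr l)"
      if r: "0 < r" and A: "0 < A" "morrey_norm p l f \<le> A" for x r A
    proof -
      have "(\<integral>\<^sup>+z\<in>ball x r. ennreal (norm (T f z) powr q) \<partial>lborel) \<le>
          ennreal (K powr q * C * A powr (q - p) * A powr p * r powr l)"
        using A r p by (intro Tf_le r A morrey_modular_le_norm fm) auto
      also have "K powr q * C * A powr (q - p) * A powr p * r powr l = (C' * A) powr q * r powr l"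
        using K C A q0 by (simp add: C'_def powr_mult powr_powr powr_diff)
      finally show ?thesis .
    qed
    \<comment> \<open>The estimates require \<open>A > 0\<close>, but the norm may be 0. For
      membership and vanishing any fixed upper bound will do.\<close>
    define A where "A = morrey_norm p l f + 1"
    have A: "0 < A" "morrey_norm p l f \<le> A"
      using morrey_norm_nonneg[OF fm] by (auto simp: A_def)
    have Tf: "T f \<in> morrey_space q l"
      using C' A by (intro morrey_spaceI(1)[of _ q "C' * A"] T f_meas q0 Tf_morrey) auto
    have "AE x in lborel. x \<noteq> 0 \<longrightarrow> D f x"
    proof -
      \<comment> \<open>The modular bound makes the \<open>q\<close>-th power of the potential
        integrable on each ball about the origin, hence finite almost everywhere there; countably
        many balls exhaust the space.\<close>
      have "AE x in lborel. ennpow q (?J x) * indicator (ball 0 (real (Suc k))) x \<noteq> \<infinity>" for k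
      proof (rule nn_integral_PInf_AE)
        have "(\<integral>\<^sup>+z\<in>ball 0 (real (Suc k)). ennpow q (?J z) \<partial>lborel) \<le>
          ennreal (C * A powr (q - p) * A powr p * real (Suc k) powr l)"
          using A p by (intro main A morrey_modular_le_norm fm) auto
        then show "(\<integral>\<^sup>+z\<in>ball 0 (real (Suc k)). ennpow q (?J z) \<partial>lborel) \<noteq> \<infinity>"
          by (auto simp: top_unique)
      qed measurable
      then have "AE x in lborel. \<forall>k. ennpow q (?J x) * indicator (ball 0 (real (Suc k))) x \<noteq> \<infinity>"
        by (simp add: AE_all_countable)
      then show ?thesis
      proof eventually_elim
        case (elim x)
        obtain k where "norm x < real k" using reals_Archimedean2 by blast
        then have "x \<in> ball 0 (real (Suc k))" by simp
        then have "ennpow q (?J x) \<noteq> top" using elim[rule_format, of k] by simp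
        then have "?J x < \<infinity>" by (cases "?J x = top") (auto simp: less_top)
        then show ?case using D[OF f_meas] unfolding J by auto
      qed
    qed
    then have "AE x in lborel. D f x"
      using AE_lborel_singleton[of 0] by eventually_elim auto
    then have 1: "AE x in lebesgue. D f x" by (rule AE_completion)
    have 2: "T f \<in> vanishing_morrey_space q l"
    proof (rule vanishing_morrey_spaceI[OF Tf])
      fix e :: real assume e: "0 < e"
      \<comment> \<open>With \<open>A\<close> fixed, the modular of \<open>T f\<close> is at most a
        constant times \<open>B\<close>; this \<open>B\<close> makes the product equal to
        \<open>e\<close>.\<close>
      define B where "B = e / (K powr q * C * A powr (q - p))"
      have B: "0 < B" using e K C A by (simp add: B_def)
      have Be: "K powr q * C * A powr (q - p) * B = e" using K C A by (simp add: B_def)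
      obtain R where R: "0 < R" "\<And>x r. R \<le> r \<Longrightarrow> morrey_modular p l f x r \<le> B"
        using vanishing_morrey_space_tail[OF f _ B] p by auto
      have "morrey_modular q l (T f) x r \<le> e" if "R \<le> r" for r x
      proof (rule morrey_modular_le)
        show "locally_p_integrable q (T f)" using Tf by (simp add: morrey_space_def)
        show "0 < r" using that R by simp
        show "0 \<le> e" using e by simp
        have "(\<integral>\<^sup>+z\<in>ball x r. ennreal (norm (T f z) powr q) \<partial>lborel) \<le>
            ennreal (K powr q * C * A powr (q - p) * B * r powr l)"
          using that R by (intro Tf_le \<open>0 < r\<close> A B) auto
        then show "(\<integral>\<^sup>+z\<in>ball x r. ennreal (norm (T f z) powr q) \<partial>lborel) \<le> ennreal (e * r powr l)"
          by (simp add: Be)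
      qed
      then show "\<exists>R. \<forall>r\<ge>R. \<forall>x. morrey_modular q l (T f) x r \<le> e" by blast
    qed
    have 3: "morrey_norm q l (T f) \<le> C' * morrey_norm p l f"
    proof (rule field_le_epsilon)
      fix e :: real assume e: "0 < e"
      \<comment> \<open>The sharp norm inequality comes from upper bounds \<open>A'\<close> that are
        positive even for norm 0; the excess contributes exactly \<open>e\<close>.\<close>
      define A' where "A' = morrey_norm p l f + e / C'"
      have A': "0 < A'" "morrey_norm p l f \<le> A'"
        using morrey_norm_nonneg[OF fm] e C' by (auto simp: A'_def intro!: add_nonneg_pos)
      have "morrey_norm q l (T f) \<le> C' * A'"
        using C' A' by (intro morrey_spaceI(2)[OF T[OF f_meas] q0 _ Tf_morrey[OF _ A']]) auto
      also have "\<dots> = C' * morrey_norm p l f + e" using C' by (simp add: A'_def field_simps)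
      finally show "morrey_norm q l (T f) \<le> C' * morrey_norm p l f + e" .
    qed
    from 1 2 3 show ?thesis by blast
  qed
  then show ?thesis unfolding bounded_on_vanishing_morrey_def by blast
qed

subsection \<open>Kernel operators\<close>

text \<open>Applies the real case to each coordinate; the finitely many exceptional null sets have a
  null union.\<close>

lemma completion_ex_borel_measurable_euclidean:
  fixes f :: "'a \<Rightarrow> 'b::euclidean_space"
  assumes [measurable]: "f \<in> borel_measurable (completion M)"
  obtains g where "g \<in> borel_measurable M" "AE y in M. f y = g y"
proof -
  have "\<forall>b\<in>Basis. \<exists>h. h \<in> borel_measurable M \<and> (AE y in M. f y \<bullet> b = h y)"
  proof
    fix b :: 'b
    have "(\<lambda>y. f y \<bullet> b) \<in> borel_measurable (completion M)" by measurable
    from completion_ex_borel_measurable_real[OF this]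
    show "\<exists>h. h \<in> borel_measurable M \<and> (AE y in M. f y \<bullet> b = h y)" by blast
  qed
  then obtain h where h: "\<And>b. b \<in> Basis \<Longrightarrow> h b \<in> borel_measurable M"
    "\<And>b. b \<in> Basis \<Longrightarrow> AE y in M. f y \<bullet> b = h b y"
    unfolding bchoice_iff by blast
  show ?thesis
  proof (rule that[of "\<lambda>y. \<Sum>b\<in>Basis. h b y *\<^sub>R b"])
    show "(\<lambda>y. \<Sum>b\<in>Basis. h b y *\<^sub>R b) \<in> borel_measurable M"
      using h(1) by (intro borel_measurable_sum borel_measurable_scaleR) auto
    have "AE y in M. \<forall>b\<in>Basis. f y \<bullet> b = h b y"
      using h(2) by (simp add: AE_finite_all)
    then show "AE y in M. f y = (\<Sum>b\<in>Basis. h b y *\<^sub>R b)"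
    proof eventually_elim
      case (elim y)
      have "f y = (\<Sum>b\<in>Basis. (f y \<bullet> b) *\<^sub>R b)" by (simp add: euclidean_representation)
      also have "\<dots> = (\<Sum>b\<in>Basis. h b y *\<^sub>R b)" using elim by (intro sum.cong) auto
      finally show ?case .
    qed
  qed
qed

text \<open>Replacing \<open>f\<close> by a Borel function makes the integrand measurable on the
  product of the Borel spaces. The exceptional null set does not depend on \<open>x\<close>, so the
  integral is unchanged for every \<open>x\<close>.\<close>

lemma borel_measurable_kernel_integral:
  fixes f :: "'a::euclidean_space \<Rightarrow> 'b::euclidean_space" and k :: "'a \<Rightarrow> 'a \<Rightarrow> real"
  assumes f [measurable]: "f \<in> borel_measurable lebesgue"
    and k [measurable]: "case_prod k \<in> borel_measurable (borel \<Otimes>\<^sub>M borel)"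
  shows "(\<lambda>x. LINT y|lebesgue. k x y *\<^sub>R f y) \<in> borel_measurable lebesgue"
proof -
  obtain g where g[measurable]: "g \<in> borel_measurable lborel" and ae: "AE y in lborel. f y = g y"
    using completion_ex_borel_measurable_euclidean[OF f] by blast
  have g'[measurable]: "g \<in> borel_measurable lebesgue" by (rule measurable_completion) (rule g)
  have ae': "AE y in lebesgue. f y = g y" using ae by (rule AE_completion)
  have "(LINT y|lebesgue. k x y *\<^sub>R f y) = (LINT y|lborel. k x y *\<^sub>R g y)" for x
  proof -
    have kx[measurable]: "k x \<in> borel_measurable borel" by measurable
    have kx'[measurable]: "k x \<in> borel_measurable lebesgue"
      by (rule measurable_completion) simp
    have "(LINT y|lebesgue. k x y *\<^sub>R f y) = (LINT y|lebesgue. k x y *\<^sub>R g y)"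
      using ae' by (intro integral_cong_AE) (auto elim: eventually_mono)
    also have "\<dots> = (LINT y|lborel. k x y *\<^sub>R g y)"
      by (rule integral_completion) measurable
    finally show ?thesis .
  qed
  moreover have "(\<lambda>x. LINT y|lborel. k x y *\<^sub>R g y) \<in> borel_measurable lborel"
    by (rule lborel.borel_measurable_lebesgue_integral) measurable
  ultimately show ?thesis by (simp add: measurable_completion)
qed

lemma
  fixes f :: "'a::euclidean_space \<Rightarrow> 'b::euclidean_space" and k :: "'a \<Rightarrow> real"
  assumes f [measurable]: "f \<in> borel_measurable lebesgue" and k [measurable]: "k \<in> borel_measurable lebesgue"
    and c: "0 \<le> c" and le: "\<And>y. y \<noteq> x \<Longrightarrow> \<bar>k y\<bar> \<le> c * norm (x - y) powr (a - real DIM('a))"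
  shows integrable_kernel: "riesz_ext a (\<lambda>y. norm (f y)) x < \<infinity> \<Longrightarrow> integrable lebesgue (\<lambda>y. k y *\<^sub>R f y)"
    and norm_kernel_integral_le:
      "ennreal (norm (LINT y|lebesgue. k y *\<^sub>R f y)) \<le> ennreal c * riesz_ext a (\<lambda>y. norm (f y)) x"
proof -
  let ?J = "riesz_ext a (\<lambda>y. norm (f y)) x"
  have f': "(\<lambda>y. norm (f y)) \<in> borel_measurable lebesgue" by measurable
  have "(\<integral>\<^sup>+y. ennreal (norm (k y *\<^sub>R f y)) \<partial>lebesgue) \<le>
      (\<integral>\<^sup>+y. ennreal c * ennreal (norm (f y) * norm (x - y) powr (a - real DIM('a))) \<partial>lebesgue)"
  proof (rule nn_integral_mono_AE)
    have "AE y in lebesgue. y \<noteq> x" by (rule AE_completion) (rule AE_lborel_singleton)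
    then show "AE y in lebesgue. ennreal (norm (k y *\<^sub>R f y)) \<le>
        ennreal c * ennreal (norm (f y) * norm (x - y) powr (a - real DIM('a)))"
    proof eventually_elim
      case (elim y)
      have "\<bar>k y\<bar> * norm (f y) \<le> c * norm (x - y) powr (a - real DIM('a)) * norm (f y)"
        using le[OF elim] by (intro mult_right_mono) auto
      then show ?case using c by (simp add: mult_ac flip: ennreal_mult)
    qed
  qed
  also have "\<dots> = ennreal c * ?J"
  proof -
    have "(\<lambda>y. norm (x - y) powr (a - real DIM('a))) \<in> borel_measurable lebesgue"
      by (rule measurable_completion) measurable
    then have "(\<integral>\<^sup>+y. ennreal c * ennreal (norm (f y) * norm (x - y) powr (a - real DIM('a))) \<partial>lebesgue) =
        ennreal c * (\<integral>\<^sup>+y. ennreal (norm (f y) * norm (x - y) powr (a - real DIM('a))) \<partial>lebesgue)"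
      by (intro nn_integral_cmult measurable_compose[OF _ measurable_ennreal] borel_measurable_times f')
    then show ?thesis by (simp add: riesz_ext_def nn_integral_completion)
  qed
  finally have J: "(\<integral>\<^sup>+y. ennreal (norm (k y *\<^sub>R f y)) \<partial>lebesgue) \<le> ennreal c * ?J" .
  show "integrable lebesgue (\<lambda>y. k y *\<^sub>R f y)" if "?J < \<infinity>"
  proof (rule integrableI_bounded)
    show "(\<integral>\<^sup>+y. ennreal (norm (k y *\<^sub>R f y)) \<partial>lebesgue) < \<infinity>"
      using J that by (auto intro: le_less_trans simp: ennreal_mult_less_top)
  qed measurable
  show "ennreal (norm (LINT y|lebesgue. k y *\<^sub>R f y)) \<le> ennreal c * ?J"
  proof (cases "integrable lebesgue (\<lambda>y. k y *\<^sub>R f y)")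
    case True
    then show ?thesis using integral_norm_bound_ennreal J order_trans by blast
  next
    \<comment> \<open>The Bochner integral of a non-integrable function is 0, so the norm bound also
      holds at points where the operator is not meaningfully defined.\<close>
    case False
    then show ?thesis by (simp add: not_integrable_integral_eq)
  qed
qed

subsection \<open>The four operators\<close>

lemma riesz_potential_eq:
  "riesz_potential a f x = (LINT y|lebesgue. inverse (norm (x - y) powr (real CARD('n) - a)) *\<^sub>R f y)"
  for x :: "real ^ 'n"
  by (simp add: riesz_potential_def)

lemma hardy_eq:
  "hardy a f x = norm x powr (a - real CARD('n)) *\<^sub>R
    (LINT y|lebesgue. (if norm y < norm x then 1 else 0) *\<^sub>R f y)" for x :: "real ^ 'n"
  unfolding hardy_def set_lebesgue_integral_def
  by (rule arg_cong2[where f = scaleR, OF refl Bochner_Integration.integral_cong]) auto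

lemma dual_hardy_eq:
  "dual_hardy a f x = norm x powr a *\<^sub>R
    (LINT y|lebesgue. (if norm x < norm y then inverse (norm y ^ CARD('n)) else 0) *\<^sub>R f y)"
  for x :: "real ^ 'n"
  unfolding dual_hardy_def set_lebesgue_integral_def
  by (rule arg_cong2[where f = scaleR, OF refl Bochner_Integration.integral_cong]) auto

lemma frac_maximal_ext_eq:
  fixes f :: "real ^ 'n \<Rightarrow> 'a::euclidean_space"
  shows "frac_maximal_ext a f = maximal_fun
    (\<lambda>t. (unit_ball_vol (real CARD('n)) * t powr real CARD('n)) powr (1 - a / real CARD('n)))
    (\<lambda>y. norm (f y))"
proof
  fix x
  show "frac_maximal_ext a f x = maximal_fun
    (\<lambda>t. (unit_ball_vol (real CARD('n)) * t powr real CARD('n)) powr (1 - a / real CARD('n)))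
    (\<lambda>y. norm (f y)) x"
    unfolding frac_maximal_ext_def maximal_fun_def nn_integral_completion
    by (intro SUP_cong refl) (simp add: content_ball powr_realpow)
qed

text \<open>On \<open>ball x t\<close> the kernel is at least \<open>t powr (a - n)\<close>, so the
  mass of the ball is at most \<open>t powr (n - a)\<close> times the potential. The normalisation
  equals \<open>V powr (1 - a / n) * t powr (n - a)\<close>, and the powers of \<open>t\<close>
  cancel.\<close>

lemma frac_maximal_ext_le:
  fixes f :: "real ^ 'n \<Rightarrow> 'a::euclidean_space"
  assumes f [measurable]: "f \<in> borel_measurable lebesgue" and a: "0 < a" "a < real CARD('n)"
  shows "frac_maximal_ext a f x \<le>
    ennreal (unit_ball_vol (real CARD('n)) powr (a / real CARD('n) - 1)) * riesz_ext a (\<lambda>y. norm (f y)) x"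
proof -
  define n where "n = real CARD('n)"
  have n: "n > 0" by (simp add: n_def)
  define V where "V = unit_ball_vol n"
  have V: "V > 0" by (simp add: V_def n_def)
  let ?J = "riesz_ext a (\<lambda>y. norm (f y)) x"
  have "(\<integral>\<^sup>+y\<in>ball x t. ennreal (norm (f y)) \<partial>lborel) / ennreal ((V * t powr n) powr (1 - a / n)) \<le>
      ennreal (V powr (a / n - 1)) * ?J" if t: "0 < t" for t
  proof (rule divide_le_posI_ennreal)
    show "0 < ennreal ((V * t powr n) powr (1 - a / n))" using t V by simp
    have ker: "(\<lambda>y. norm (x - y) powr (a - n)) \<in> borel_measurable lebesgue"
      by (rule measurable_completion) measurable
    have "(\<integral>\<^sup>+y\<in>ball x t. ennreal (norm (f y)) \<partial>lborel) = (\<integral>\<^sup>+y\<in>ball x t. ennreal (norm (f y)) \<partial>lebesgue)"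
      by (simp add: nn_integral_completion)
    also have "\<dots> \<le> (\<integral>\<^sup>+y. ennreal (t powr (n - a)) * ennreal (norm (f y) * norm (x - y) powr (a - n)) \<partial>lebesgue)"
    proof (rule nn_integral_mono_AE)
      have "AE y in lebesgue. y \<noteq> x" by (rule AE_completion) (rule AE_lborel_singleton)
      then show "AE y in lebesgue. ennreal (norm (f y)) * indicator (ball x t) y \<le>
          ennreal (t powr (n - a)) * ennreal (norm (f y) * norm (x - y) powr (a - n))"
      proof eventually_elim
        case (elim y)
        show ?case
        proof (cases "y \<in> ball x t")
          case True
          have "t powr (a - n) \<le> norm (x - y) powr (a - n)"
            using True elim a by (intro powr_mono2') (auto simp: dist_norm n_def)
          then have "t powr (n - a) * t powr (a - n) \<le> t powr (n - a) * norm (x - y) powr (a - n)"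
            by (intro mult_left_mono) auto
          then have "1 \<le> t powr (n - a) * norm (x - y) powr (a - n)"
            using t by (simp flip: powr_add)
          then have "norm (f y) * 1 \<le> norm (f y) * (t powr (n - a) * norm (x - y) powr (a - n))"
            by (intro mult_left_mono) auto
          then show ?thesis using True by (simp add: mult_ac flip: ennreal_mult)
        qed simp
      qed
    qed
    also have "\<dots> = ennreal (t powr (n - a)) * ?J"
      using ker by (subst nn_integral_cmult) (simp_all add: riesz_ext_def nn_integral_completion n_def)
    also have "\<dots> = ennreal ((V * t powr n) powr (1 - a / n)) * (ennreal (V powr (a / n - 1)) * ?J)"
    proof -
      have "(V * t powr n) powr (1 - a / n) * V powr (a / n - 1) =
          (V powr (1 - a / n) * V powr (a / n - 1)) * t powr (n - a)"
        using V t n by (simp add: powr_mult powr_powr right_diff_distrib)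
      also have "V powr (1 - a / n) * V powr (a / n - 1) = 1"
        using V by (simp flip: powr_add)
      finally show ?thesis by (simp add: mult.assoc[symmetric] flip: ennreal_mult)
    qed
    finally show "(\<integral>\<^sup>+y\<in>ball x t. ennreal (norm (f y)) \<partial>lborel) \<le> \<dots>" .
  qed
  then show ?thesis
    unfolding frac_maximal_ext_eq maximal_fun_def V_def n_def by (intro SUP_least) auto
qed

text \<open>If \<open>y\<close> is closer to the origin than \<open>x\<close>, then
  \<open>norm (x - y) \<le> 2 * norm x\<close>, and the exponent \<open>a - n\<close> is negative.
  The power of \<open>norm x\<close> compensates the factor standing outside the Hardy
  integral.\<close>

lemma hardy_kernel_le:
  fixes x y :: "'a::real_normed_vector"
  assumes "a < n" "y \<noteq> x"
  shows "(if norm y < norm x then 1 else 0) \<le> (2 * norm x) powr (n - a) * norm (x - y) powr (a - n)"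
proof (cases "norm y < norm x")
  case True
  have "norm (x - y) \<le> 2 * norm x" using norm_triangle_ineq4[of x y] True by simp
  then have "(2 * norm x) powr (a - n) \<le> norm (x - y) powr (a - n)"
    using assms by (intro powr_mono2') auto
  then have "(2 * norm x) powr (n - a) * (2 * norm x) powr (a - n) \<le>
      (2 * norm x) powr (n - a) * norm (x - y) powr (a - n)"
    by (intro mult_left_mono) auto
  moreover have "(2 * norm x) powr (n - a) * (2 * norm x) powr (a - n) = 1"
    using True by (simp flip: powr_add) auto
  ultimately show ?thesis using True by simp
qed simp

text \<open>Split \<open>norm y powr - n\<close> as
  \<open>norm y powr - a * norm y powr (a - n)\<close>. For \<open>norm x < norm y\<close> the first
  factor is at most \<open>norm x powr - a\<close>, and the second is compared with the Riesz kernel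
  through \<open>norm (x - y) \<le> 2 * norm y\<close>.\<close>

lemma dual_hardy_kernel_le:
  fixes x y :: "'a::real_normed_vector"
  assumes "0 < a" "a < real n" "y \<noteq> x" "x \<noteq> 0"
  shows "(if norm x < norm y then inverse (norm y ^ n) else 0) \<le>
    (norm x powr - a * 2 powr (real n - a)) * norm (x - y) powr (a - real n)"
proof (cases "norm x < norm y")
  case True
  then have y: "norm y > 0" by (meson norm_ge_zero order_le_less_trans)
  have "norm (x - y) \<le> 2 * norm y" using norm_triangle_ineq4[of x y] True by simp
  then have "(2 * norm y) powr (a - real n) \<le> norm (x - y) powr (a - real n)"
    using assms by (intro powr_mono2') auto
  moreover have "norm y powr - a \<le> norm x powr - a"
    using assms True by (intro powr_mono2') auto
  ultimately have "norm y powr - a * 2 powr (real n - a) * (2 * norm y) powr (a - real n) \<le>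
      norm x powr - a * 2 powr (real n - a) * norm (x - y) powr (a - real n)"
    by (intro mult_mono mult_right_mono) auto
  also have "norm y powr - a * 2 powr (real n - a) * (2 * norm y) powr (a - real n) =
      (norm y powr - a * norm y powr (a - real n)) * (2 powr (real n - a) * 2 powr (a - real n))"
    by (simp add: powr_mult)
  also have "\<dots> = norm y powr - real n"
    by (simp flip: powr_add)
  also have "\<dots> = inverse (norm y ^ n)"
    using y by (simp add: powr_minus powr_realpow)
  finally show ?thesis using True by simp
qed simp

theorem theorem3p4:
  fixes a l p q :: real
  assumes "0 < a" and "a < real CARD('n)"
    and "0 \<le> l" and "l < real CARD('n)"
    and "1 < p" and "p < (real CARD('n) - l) / a"
    and "1 / q = 1 / p - a / (real CARD('n) - l)"
  shows
    "bounded_on_vanishing_morrey p q l (riesz_defined a)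
       (riesz_potential a ::
         (real ^ 'n \<Rightarrow> 'k::{real_normed_field, euclidean_space}) \<Rightarrow> real ^ 'n \<Rightarrow> 'k) \<and>
     bounded_on_vanishing_morrey p q l (frac_maximal_defined a)
       (frac_maximal a :: (real ^ 'n \<Rightarrow> 'k) \<Rightarrow> real ^ 'n \<Rightarrow> real) \<and>
     bounded_on_vanishing_morrey p q l (hardy_defined a)
       (hardy a :: (real ^ 'n \<Rightarrow> 'k) \<Rightarrow> real ^ 'n \<Rightarrow> 'k) \<and>
     bounded_on_vanishing_morrey p q l (dual_hardy_defined a)
       (dual_hardy a :: (real ^ 'n \<Rightarrow> 'k) \<Rightarrow> real ^ 'n \<Rightarrow> 'k)"
proof -
  note a = \<open>0 < a\<close> \<open>a < real CARD('n)\<close>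
  have b: "a < (real CARD('n) - l) / p"
    using assms by (simp add: field_simps)
  note bounded = bounded_on_vanishing_morrey_of_riesz_bound
    [OF a \<open>1 < p\<close> b \<open>0 \<le> l\<close> \<open>l < real CARD('n)\<close> assms(7)]
  have V: "unit_ball_vol (real CARD('n)) \<noteq> 0"
    using unit_ball_vol_pos[of "real CARD('n)"] by (metis less_irrefl of_nat_0_le_iff)
  let ?J = "\<lambda>f. riesz_ext a (\<lambda>y. norm (f y :: 'k))"
  show ?thesis
  proof (intro conjI)
    show "bounded_on_vanishing_morrey p q l (riesz_defined a)
       (riesz_potential a :: (real ^ 'n \<Rightarrow> 'k) \<Rightarrow> real ^ 'n \<Rightarrow> 'k)"
    proof (rule bounded)
      fix f :: "real ^ 'n \<Rightarrow> 'k" assume f: "f \<in> borel_measurable lebesgue"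
      show "riesz_potential a f \<in> borel_measurable lebesgue"
        unfolding riesz_potential_eq[abs_def] using f
        by (rule borel_measurable_kernel_integral) measurable
      fix x :: "real ^ 'n"
      have k: "(\<lambda>y. inverse (norm (x - y) powr (real CARD('n) - a))) \<in> borel_measurable lebesgue"
        by (rule measurable_completion) measurable
      have le: "\<bar>inverse (norm (x - y) powr (real CARD('n) - a))\<bar> \<le>
          1 * norm (x - y) powr (a - real DIM(real ^ 'n))" for y
        using powr_minus[of "norm (x - y)" "real CARD('n) - a"] by simp
      show "riesz_defined a f x" if "?J f x < \<infinity>"
        unfolding riesz_defined_def using integrable_kernel[OF f k _ le that] by simp
      show "ennreal (norm (riesz_potential a f x)) \<le> ennreal 1 * ?J f x"
        unfolding riesz_potential_eq by (intro norm_kernel_integral_le f k le) auto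
    qed simp
    show "bounded_on_vanishing_morrey p q l (frac_maximal_defined a)
       (frac_maximal a :: (real ^ 'n \<Rightarrow> 'k) \<Rightarrow> real ^ 'n \<Rightarrow> real)"
    proof (rule bounded)
      fix f :: "real ^ 'n \<Rightarrow> 'k" assume f: "f \<in> borel_measurable lebesgue"
      have "frac_maximal_ext a f \<in> borel_measurable borel"
        unfolding frac_maximal_ext_eq
        by (intro borel_measurable_maximal_fun continuous_intros) (use V in auto)
      then have "frac_maximal a f \<in> borel_measurable borel"
        unfolding frac_maximal_def[abs_def] by measurable
      then show "frac_maximal a f \<in> borel_measurable lebesgue"
        by (intro measurable_completion) simp
      fix x :: "real ^ 'n"
      note le = frac_maximal_ext_le[OF f a, of x]
      show "frac_maximal_defined a f x" if "?J f x < \<infinity>"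
        unfolding frac_maximal_defined_def using that
        by (intro le_less_trans[OF le]) (auto simp: ennreal_mult_less_top)
      \<comment> \<open>\<open>enn2real\<close> turns an infinite value into 0, so the real-valued
        maximal function is below the extended one at every point.\<close>
      have "ennreal (norm (frac_maximal a f x)) \<le> frac_maximal_ext a f x"
        by (simp add: frac_maximal_def ennreal_enn2real_if)
      also note le
      finally show "ennreal (norm (frac_maximal a f x)) \<le>
          ennreal (unit_ball_vol (real CARD('n)) powr (a / real CARD('n) - 1)) * ?J f x" .
    qed (use V in simp)
    show "bounded_on_vanishing_morrey p q l (hardy_defined a)
       (hardy a :: (real ^ 'n \<Rightarrow> 'k) \<Rightarrow> real ^ 'n \<Rightarrow> 'k)"
    proof (rule bounded)
      fix f :: "real ^ 'n \<Rightarrow> 'k" assume f: "f \<in> borel_measurable lebesgue"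
      have "(\<lambda>x :: real ^ 'n. norm x powr (a - real CARD('n))) \<in> borel_measurable lebesgue"
        by (rule measurable_completion) measurable
      moreover have "(\<lambda>x :: real ^ 'n. LINT y|lebesgue. (if norm y < norm x then 1 else 0) *\<^sub>R f y) \<in> borel_measurable lebesgue"
        using f by (rule borel_measurable_kernel_integral) measurable
      ultimately show "hardy a f \<in> borel_measurable lebesgue"
        unfolding hardy_eq[abs_def] by measurable
      fix x :: "real ^ 'n"
      have k: "(\<lambda>y. if norm y < norm x then 1 else 0 :: real) \<in> borel_measurable lebesgue"
        by (rule measurable_completion) measurable
      have le: "\<bar>if norm y < norm x then 1 else 0\<bar> \<le>
          (2 * norm x) powr (real CARD('n) - a) * norm (x - y) powr (a - real DIM(real ^ 'n))"
        if "y \<noteq> x" for y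
        using hardy_kernel_le[OF a(2) that] by simp
      show "hardy_defined a f x" if "?J f x < \<infinity>"
        using integrable_kernel[OF f k _ le that]
        by (simp add: hardy_defined_def set_integrable_def indicator_def of_bool_def)
      have "ennreal (norm (hardy a f x)) = ennreal (norm x powr (a - real CARD('n))) *
          ennreal (norm (LINT y|lebesgue. (if norm y < norm x then 1 else 0) *\<^sub>R f y))"
        by (simp add: hardy_eq ennreal_mult)
      also have "\<dots> \<le> ennreal (norm x powr (a - real CARD('n))) *
          (ennreal ((2 * norm x) powr (real CARD('n) - a)) * ?J f x)"
        by (intro mult_left_mono norm_kernel_integral_le f k le) auto
      also have "\<dots> = ennreal (norm x powr (a - real CARD('n)) * (2 * norm x) powr (real CARD('n) - a)) * ?J f x"
        by (simp add: ennreal_mult mult.assoc)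
      also have "\<dots> \<le> ennreal (2 powr (real CARD('n) - a)) * ?J f x"
      proof (intro mult_right_mono ennreal_leI)
        \<comment> \<open>The product is 1 except at the origin, where both powers are 0.\<close>
        have "norm x powr (a - real CARD('n)) * norm x powr (real CARD('n) - a) \<le> 1"
          by (simp flip: powr_add)
        then show "norm x powr (a - real CARD('n)) * (2 * norm x) powr (real CARD('n) - a) \<le> 2 powr (real CARD('n) - a)"
          by (simp add: powr_mult mult.left_commute[of _ "2 powr _"] mult_left_le)
      qed auto
      finally show "ennreal (norm (hardy a f x)) \<le> ennreal (2 powr (real CARD('n) - a)) * ?J f x" .
    qed simp
    show "bounded_on_vanishing_morrey p q l (dual_hardy_defined a)
       (dual_hardy a :: (real ^ 'n \<Rightarrow> 'k) \<Rightarrow> real ^ 'n \<Rightarrow> 'k)"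
    proof (rule bounded)
      fix f :: "real ^ 'n \<Rightarrow> 'k" assume f: "f \<in> borel_measurable lebesgue"
      have "(\<lambda>x :: real ^ 'n. norm x powr a) \<in> borel_measurable lebesgue"
        by (rule measurable_completion) measurable
      moreover have "(\<lambda>x :: real ^ 'n. LINT y|lebesgue. (if norm x < norm y then inverse (norm y ^ CARD('n)) else 0) *\<^sub>R f y)
          \<in> borel_measurable lebesgue"
        using f by (rule borel_measurable_kernel_integral) measurable
      ultimately show "dual_hardy a f \<in> borel_measurable lebesgue"
        unfolding dual_hardy_eq[abs_def] by measurable
      fix x :: "real ^ 'n"
      have k: "(\<lambda>y :: real ^ 'n. if norm x < norm y then inverse (norm y ^ CARD('n)) else 0) \<in> borel_measurable lebesgue"
        by (rule measurable_completion) measurable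
      have le: "\<bar>if norm x < norm y then inverse (norm y ^ CARD('n)) else 0\<bar> \<le>
          (norm x powr - a * 2 powr (real CARD('n) - a)) * norm (x - y) powr (a - real DIM(real ^ 'n))"
        if "x \<noteq> 0" "y \<noteq> x" for y
        using dual_hardy_kernel_le[OF a that(2,1)] by simp
      show "dual_hardy_defined a f x" if "x \<noteq> 0" "?J f x < \<infinity>"
      proof -
        have eq: "indicator {y. norm x < norm y} y *\<^sub>R (f y /\<^sub>R norm y ^ CARD('n)) =
          (if norm x < norm y then inverse (norm y ^ CARD('n)) else 0) *\<^sub>R f y" for y
          by (simp add: indicator_def)
        show ?thesis
          unfolding dual_hardy_defined_def set_integrable_def eq
          using integrable_kernel[OF f k _ le[OF that(1)] that(2)] by simp
      qed
      show "ennreal (norm (dual_hardy a f x)) \<le> ennreal (2 powr (real CARD('n) - a)) * ?J f x"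
      proof (cases "x = 0")
        case False
        have "ennreal (norm (dual_hardy a f x)) = ennreal (norm x powr a) * ennreal (norm
            (LINT y|lebesgue. (if norm x < norm y then inverse (norm y ^ CARD('n)) else 0) *\<^sub>R f y))"
          by (simp add: dual_hardy_eq ennreal_mult)
        also have "\<dots> \<le> ennreal (norm x powr a) *
            (ennreal (norm x powr - a * 2 powr (real CARD('n) - a)) * ?J f x)"
          by (intro mult_left_mono norm_kernel_integral_le f k le[OF False]) auto
        also have "\<dots> = ennreal (norm x powr a * norm x powr - a * 2 powr (real CARD('n) - a)) * ?J f x"
          by (simp add: ennreal_mult mult.assoc)
        also have "norm x powr a * norm x powr - a = 1"
          using False by (simp flip: powr_add)
        finally show ?thesis by simp
      qed (simp add: dual_hardy_eq)
    qed simp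
  qed
qed

end
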